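(* Let $\varphi$ be a nonnegative Borel function on $\mathbb{D}$. (a) If $\varphi$ admits a harmonic majorant, then $M\varphi\in L^1_w(\partial\mathbb{D})$. (b) If $\varphi$ admits a positive quasi-bounded harmonic majorant, then $M\varphi\in L^1_{w,0}(\partial\mathbb{D})$. (c) If $M\varphi\in L^1(\partial\mathbb{D})$, then the function $\varphi$ admits $P[M\varphi]:=P[M\varphi\,d\sigma]$ as a quasi-bounded harmonic majorant.
   Context: $\mathbb{D}$ is the open unit disc and $\sigma$ is normalized Lebesgue measure on $\partial\mathbb{D}$. The Stolz angle with vertex $\zeta\in\partial\mathbb{D}$ and aperture $\alpha$ is $\Gamma_\alpha(\zeta)=\{z\in\mathbb{D}:|z-\zeta|\le\alpha(1-|z|^2)\}$; the value of $\alpha$ is regarded as of no importance, and $\Gamma(\zeta)$ denotes the generic Stolz angle with aperture $\alpha$. For $f:\mathbb{D}\to\mathbb{R}_+$, the non-tangential maximal function is $Mf(\zeta)=\sup_{\Gamma(\zeta)}f$, $\zeta\in\partial\mathbb{D}$. $L^1_w(\partial\mathbb{D})$ is the set of measurable $f$ with $\sup_{t>0}t\,\sigma\{\zeta:|f(\zeta)|>t\}<\infty$; $L^1_{w,0}(\partial\mathbb{D})$ is the set of measurable $f$ with $\lim_{t\to\infty}t\,\sigma\{\zeta:|f(\zeta)|>t\}=0$. $P_z(\zeta)=\frac{1-|z|^2}{|\zeta-z|^2}$ is the Poisson kernel and $P[\mu](z)=\int_{\partial\mathbb{D}}P_z(\zeta)\,d\mu(\zeta)$ is the Poisson integral of a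 measure $\mu$ on $\partial\mathbb{D}$. A harmonic majorant of $\varphi$ is a harmonic function $h$ on $\mathbb{D}$ with $h(z)\ge\varphi(z)$ for every $z\in\mathbb{D}$ (since $\varphi\ge0$, such an $h$ is nonnegative). A harmonic function is quasi-bounded if it is the Poisson integral of a boundary measure that is absolutely continuous with respect to Lebesgue measure.
   Formalization: In (c) the majorant is C·P[Mφ] with C>0 depending only on the aperture α, and α≥1 is assumed; with constant 1 the claim fails (φ the indicator of one point near the circle), and for α<1 it fails for any constant (φ the indicator of the origin). P[Mφ] is still proved quasi-bounded. *)

theory Defs
  imports "HOL-Complex_Analysis.Complex_Analysis"
begin

abbreviation unit_disc :: "complex set" where
  "unit_disc \<equiv> ball 0 1"

definition circle_lborel :: "complex measure" where
  "circle_lborel =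
     distr (uniform_measure lborel {0..2 * pi}) (restrict_space borel (sphere 0 1)) cis"

text \<open>Normalized Lebesgue measure on the unit circle, on the Lebesgue (completed) sets, in the
  same way as \<^const>\<open>lebesgue\<close> is the completion of \<^const>\<open>lborel\<close>.\<close>

definition circle_lebesgue :: "complex measure" where
  "circle_lebesgue = completion circle_lborel"

definition stolz_angle :: "real \<Rightarrow> complex \<Rightarrow> complex set" where
  "stolz_angle \<alpha> \<zeta> = {z \<in> unit_disc. norm (z - \<zeta>) \<le> \<alpha> * (1 - (norm z)\<^sup>2)}"

text \<open>The supremum may be infinite, so it is taken in \<^typ>\<open>ennreal\<close>; the embedding is faithful
  for functions that are nonnegative on the disc.\<close>

definition nt_max :: "real \<Rightarrow> (complex \<Rightarrow> real) \<Rightarrow> complex \<Rightarrow> ennreal" where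
  "nt_max \<alpha> \<phi> \<zeta> = (SUP z\<in>stolz_angle \<alpha> \<zeta>. ennreal (\<phi> z))"

text \<open>The spaces below are restricted to functions with values in \<open>[0, \<infinity>]\<close>, so that no absolute
  value is needed.\<close>

definition weak_L1 :: "(complex \<Rightarrow> ennreal) set" where
  "weak_L1 = {f \<in> borel_measurable circle_lebesgue.
     (SUP t\<in>{0::real<..}.
        ennreal t * emeasure circle_lebesgue {\<zeta> \<in> sphere 0 1. ennreal t < f \<zeta>}) < \<infinity>}"

definition weak_L1_0 :: "(complex \<Rightarrow> ennreal) set" where
  "weak_L1_0 = {f \<in> borel_measurable circle_lebesgue.
     ((\<lambda>t::real. t * measure circle_lebesgue {\<zeta> \<in> sphere 0 1. ennreal t < f \<zeta>}) \<longlongrightarrow> 0) at_top}"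

definition L1 :: "(complex \<Rightarrow> ennreal) set" where
  "L1 = {f \<in> borel_measurable circle_lebesgue. (\<integral>\<^sup>+\<zeta>. f \<zeta> \<partial>circle_lebesgue) < \<infinity>}"

definition poisson_kernel :: "complex \<Rightarrow> complex \<Rightarrow> real" where
  "poisson_kernel z \<zeta> = (1 - (norm z)\<^sup>2) / (norm (\<zeta> - z))\<^sup>2"

definition poisson_integral :: "complex measure \<Rightarrow> complex \<Rightarrow> real" where
  "poisson_integral \<mu> z = (LINT \<zeta>|\<mu>. poisson_kernel z \<zeta>)"

text \<open>Twice continuously differentiable with vanishing Laplacian: \<open>hx\<close>, \<open>hy\<close> are the first and
  \<open>hxx\<close>, \<open>hxy\<close>, \<open>hyx\<close>, \<open>hyy\<close> the second partial derivatives of \<open>h\<close>.\<close>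

definition harmonic_on :: "(complex \<Rightarrow> real) \<Rightarrow> complex set \<Rightarrow> bool" where
  "harmonic_on h S \<longleftrightarrow> open S \<and>
     (\<exists>hx hy hxx hxy hyx hyy :: complex \<Rightarrow> real.
        (\<forall>z\<in>S. (h has_derivative (\<lambda>v. hx z * Re v + hy z * Im v)) (at z) \<and>
               (hx has_derivative (\<lambda>v. hxx z * Re v + hxy z * Im v)) (at z) \<and>
               (hy has_derivative (\<lambda>v. hyx z * Re v + hyy z * Im v)) (at z) \<and>
               hxx z + hyy z = 0) \<and>
        continuous_on S hxx \<and> continuous_on S hxy \<and>
        continuous_on S hyx \<and> continuous_on S hyy)"

definition harmonic_majorant :: "(complex \<Rightarrow> real) \<Rightarrow> (complex \<Rightarrow> real) \<Rightarrow> bool" where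
  "harmonic_majorant \<phi> h \<longleftrightarrow> harmonic_on h unit_disc \<and> (\<forall>z\<in>unit_disc. \<phi> z \<le> h z)"

definition ac_boundary_measure :: "complex measure \<Rightarrow> bool" where
  "ac_boundary_measure \<mu> \<longleftrightarrow> finite_measure \<mu> \<and> sets \<mu> = sets circle_lborel \<and>
     absolutely_continuous circle_lborel \<mu>"

text \<open>The representing measure may be signed. By the Jordan decomposition, an absolutely continuous
  signed Borel measure is a difference \<open>\<mu> - \<nu>\<close> of two finite positive absolutely continuous
  ones.\<close>

definition quasi_bounded :: "(complex \<Rightarrow> real) \<Rightarrow> bool" where
  "quasi_bounded h \<longleftrightarrow> harmonic_on h unit_disc \<and>
     (\<exists>\<mu> \<nu>. ac_boundary_measure \<mu> \<and> ac_boundary_measure \<nu> \<and>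
        (\<forall>z\<in>unit_disc. h z = poisson_integral \<mu> z - poisson_integral \<nu> z))"

definition nonneg_borel :: "(complex \<Rightarrow> real) \<Rightarrow> bool" where
  "nonneg_borel \<phi> \<longleftrightarrow> \<phi> \<in> borel_measurable (restrict_space borel unit_disc) \<and>
     (\<forall>z\<in>unit_disc. 0 \<le> \<phi> z)"

end

theory Submission
  imports Defs
begin

text \<open>Each superlevel set of the nontangential maximal function is a union of arcs, hence Borel up to
  the countably many endpoints of the arcs. For a Poisson integral of a measure \<open>\<mu>\<close> the value in a
  Stolz angle is dominated by the Hardy--Littlewood maximal function of \<open>\<mu>\<close> at the vertex, and
  Vitali's covering lemma gives the weak type bound by the total mass. Part (a) applies this to
  dilates of the harmonic majorant; part (b) splits an integrable density into a bounded part and a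
  part of small mass. For (c), the points whose Stolz angle contains \<open>z\<close> form an arc of length at
  least comparable to \<open>1 - |z|\<close>, on which the maximal function is at least \<open>\<phi> z\<close> and the
  Poisson kernel at least a multiple of \<open>1 / (1 - |z|)\<close>.\<close>

section \<open>Measurability of the nontangential maximal function\<close>

text \<open>Since \<open>\<phi>\<close> is merely Borel, a superlevel set of \<open>nt_max\<close>
  can be an uncountable union of closed arcs, with no semicontinuity to help. What tames it is that
  only countably many points can border an interval of a given set of angles from outside. In (a) no
  boundary measure of the majorant is constructed. The weak type constant depends on the aperture
  alone and every dilate has mass \<open>h 0\<close>, so the bound survives the limit. Proving the
  estimate for arbitrary measures on the circle is what lets (b) use it for a truncated density. In
  (c) a factor \<open>C\<close> is unavoidable for a fixed aperture: if \<open>\<phi>\<close> is the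
  indicator of one point \<open>z\<close> near the circle, its maximal function is at most the
  indicator of a proper arc, whose Poisson integral at \<open>z\<close> is below 1. The condition
  \<open>1 \<le> \<alpha>\<close> makes every point of the disc visible from the circle; for smaller
  apertures the origin lies in no Stolz angle.\<close>

lemma space_circle_lborel [simp]: "space circle_lborel = sphere 0 1"
  by (simp add: circle_lborel_def)

lemma sets_circle_lborel [measurable_cong]:
  "sets circle_lborel = sets (restrict_space borel (sphere 0 1))"
  by (simp add: circle_lborel_def)

lemma sets_circle_lborel_iff:
  "A \<in> sets circle_lborel \<longleftrightarrow> A \<subseteq> sphere 0 1 \<and> A \<in> sets borel"
  by (simp add: sets_circle_lborel sets_restrict_space_iff)

lemma measurable_cis_circle [measurable]:
  "cis \<in> borel \<rightarrow>\<^sub>M restrict_space borel (sphere 0 1)"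
  by (rule measurable_restrict_space2) (auto intro!: borel_measurable_continuous_onI continuous_intros)

lemma nn_integral_circle_lborel:
  assumes [measurable]: "f \<in> borel_measurable circle_lborel"
  shows "(\<integral>\<^sup>+\<eta>. f \<eta> \<partial>circle_lborel) =
         (\<integral>\<^sup>+t. f (cis t) * indicator {0..2 * pi} t \<partial>lborel) / ennreal (2 * pi)"
proof -
  have f [measurable]: "f \<in> borel_measurable (restrict_space borel (sphere 0 1))"
    using assms by (simp cong: measurable_cong_sets add: sets_circle_lborel)
  show ?thesis
    unfolding circle_lborel_def
    by (subst nn_integral_distr) (simp_all add: nn_integral_uniform_measure)
qed

lemma sphere_in_sets_circle_lborel [simp, measurable]: "sphere 0 1 \<in> sets circle_lborel"
  by (simp add: sets_circle_lborel_iff)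

lemma cis_preimage_sets:
  assumes "A \<in> sets circle_lborel"
  shows "{t\<in>{0..2 * pi}. cis t \<in> A} \<in> sets lborel"
proof -
  have "{t\<in>{0..2 * pi}. cis t \<in> A} = {0..2 * pi} \<inter> (cis -` A \<inter> space borel)" by auto
  also have "\<dots> \<in> sets lborel"
    using measurable_sets[OF measurable_cis_circle, of A] assms
    by (simp add: sets_circle_lborel)
  finally show ?thesis .
qed

lemma emeasure_circle_lborel:
  assumes "A \<in> sets circle_lborel"
  shows "emeasure circle_lborel A = emeasure lborel {t\<in>{0..2 * pi}. cis t \<in> A} / ennreal (2 * pi)"
proof -
  have [measurable]: "A \<in> sets borel" using assms by (simp add: sets_circle_lborel_iff)
  have "emeasure circle_lborel A = (\<integral>\<^sup>+\<eta>. indicator A \<eta> \<partial>circle_lborel)"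
    using assms by simp
  also have "\<dots> = (\<integral>\<^sup>+t. indicator {t\<in>{0..2 * pi}. cis t \<in> A} t \<partial>lborel) / ennreal (2 * pi)"
    using assms by (subst nn_integral_circle_lborel)
      (simp, intro arg_cong2[where f="(/)"] nn_integral_cong refl, simp split: split_indicator)
  also have "(\<integral>\<^sup>+t. indicator {t\<in>{0..2 * pi}. cis t \<in> A} t \<partial>lborel) =
      emeasure lborel {t\<in>{0..2 * pi}. cis t \<in> A}"
    by (rule nn_integral_indicator[OF cis_preimage_sets[OF assms]])
  finally show ?thesis .
qed

lemma emeasure_space_circle_lborel [simp]: "emeasure circle_lborel (sphere 0 1) = 1"
proof -
  have "{t\<in>{0..2 * pi}. cis t \<in> sphere 0 1} = {0..2 * pi}" by auto
  then have "emeasure circle_lborel (sphere 0 1) = emeasure lborel {0..2 * pi} / ennreal (2 * pi)"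
    using emeasure_circle_lborel[of "sphere 0 1"] by (simp only: sets_circle_lborel_iff) simp
  also have "\<dots> = 1" by (simp add: divide_ennreal)
  finally show ?thesis .
qed

lemma finite_measure_circle_lborel: "finite_measure circle_lborel"
  by (rule finite_measureI) simp

text \<open>Each such \<open>t\<close> is assigned a rational in the interval that follows it. The
  choice is injective: if \<open>x < y\<close> shared a rational, \<open>y\<close> would lie in the
  interval of \<open>W\<close> that starts at \<open>x\<close>.\<close>

lemma countable_left_gap_ends:
  fixes W :: "real set"
  shows "countable {t. t \<notin> W \<and> (\<exists>e>0. {t<..<t+e} \<subseteq> W)}" (is "countable ?T")
proof -
  have "\<forall>t\<in>?T. \<exists>q. q \<in> \<rat> \<and> t < q \<and> {t<..q} \<subseteq> W"
  proof
    fix t assume "t \<in> ?T"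
    then obtain e where e: "e > 0" "{t<..<t+e} \<subseteq> W" by auto
    obtain q where q: "q \<in> \<rat>" "t < q" "q < t + e"
      using Rats_dense_in_real[of t "t+e"] e by auto
    show "\<exists>q. q \<in> \<rat> \<and> t < q \<and> {t<..q} \<subseteq> W"
      using q e by (intro exI[of _ q]) auto
  qed
  from bchoice[OF this]
  obtain q where q: "\<forall>t\<in>?T. q t \<in> \<rat> \<and> t < q t \<and> {t<..q t} \<subseteq> W" ..
  have "inj_on q ?T"
  proof (rule linorder_inj_onI)
    fix x y assume xy: "x < y" "x \<in> ?T" "y \<in> ?T"
    show "q x \<noteq> q y"
    proof
      assume "q x = q y"
      then have "y \<in> {x<..q x}" using bspec[OF q xy(3)] xy by auto
      then show False using bspec[OF q xy(2)] xy by auto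
    qed
  qed auto
  moreover have "countable (q ` ?T)"
    by (rule countable_subset[OF _ countable_rat]) (use q in auto)
  ultimately show ?thesis using countable_image_inj_on by blast
qed

lemma countable_right_gap_ends:
  fixes W :: "real set"
  shows "countable {t. t \<notin> W \<and> (\<exists>e>0. {t-e<..<t} \<subseteq> W)}" (is "countable ?T")
proof -
  have "?T \<subseteq> uminus ` {t. t \<notin> uminus ` W \<and> (\<exists>e>0. {t<..<t+e} \<subseteq> uminus ` W)}"
  proof
    fix t assume "t \<in> ?T"
    then obtain e where e: "t \<notin> W" "e > 0" "{t-e<..<t} \<subseteq> W" by auto
    have "{-t<..<-t+e} \<subseteq> uminus ` W"
    proof
      fix x assume "x \<in> {-t<..<-t+e}"
      then have "-x \<in> W" using e by auto
      then show "x \<in> uminus ` W" by force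
    qed
    then show "t \<in> uminus ` {t. t \<notin> uminus ` W \<and> (\<exists>e>0. {t<..<t+e} \<subseteq> uminus ` W)}"
      using e by (intro image_eqI[of _ _ "-t"]) auto
  qed
  then show ?thesis
    by (rule countable_subset) (intro countable_image countable_left_gap_ends)
qed

section \<open>Arcs of vertices whose Stolz angle contains a given point\<close>

lemma norm_cis_diff_sq:
  "(norm (cis t - of_real r * cis \<beta>))\<^sup>2 = 1 + r\<^sup>2 - 2 * r * cos (t - \<beta>)"
proof -
  have "(norm (cis t - of_real r * cis \<beta>))\<^sup>2 =
     ((cos t)\<^sup>2 + (sin t)\<^sup>2) + r\<^sup>2 * ((cos \<beta>)\<^sup>2 + (sin \<beta>)\<^sup>2) - 2 * r * (cos t * cos \<beta> + sin t * sin \<beta>)"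
    unfolding cmod_power2 by (simp add: power2_diff power_mult_distrib sin_squared_eq algebra_simps)
  then show ?thesis by (simp add: cos_diff)
qed

text \<open>By the law of cosines \<open>cis s\<close> approaches \<open>z\<close> as
  \<open>s\<close> moves towards the argument of \<open>z\<close>. From a point at exactly the
  critical distance a small move to one side therefore leads into the open arc, unless the point
  already lies in the direction of \<open>z\<close> or \<open>z = 0\<close>. In these cases the
  critical equation reads \<open>1 - r = \<alpha> * (1 - r^2)\<close> and forces
  \<open>r = 1/\<alpha> - 1\<close>.\<close>

lemma arc_end:
  assumes z: "norm z < 1" and at: "norm (cis t - z) = \<alpha> * (1 - (norm z)\<^sup>2)"
  shows "(\<alpha> > 0 \<and> 1/\<alpha> - 1 \<ge> 0 \<and> of_real (1/\<alpha> - 1) * cis t = z) \<or>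
    (\<exists>e>0. \<forall>s\<in>{t<..<t+e}. norm (cis s - z) < \<alpha> * (1 - (norm z)\<^sup>2)) \<or>
    (\<exists>e>0. \<forall>s\<in>{t-e<..<t}. norm (cis s - z) < \<alpha> * (1 - (norm z)\<^sup>2))"
proof -
  define r where "r = norm z"
  have r: "0 \<le> r" "r < 1" using z by (auto simp: r_def)
  \<comment> \<open>\<open>\<gamma>\<close> is the signed angle from \<open>z\<close> to
    \<open>cis t\<close>, taken between \<open>-pi\<close> and \<open>pi\<close> so that
    \<open>cos\<close> is monotone between 0 and \<open>\<gamma>\<close>; \<open>\<beta>\<close> is
    then the matching lift of the argument of \<open>z\<close>.\<close>
  define \<gamma> where "\<gamma> = Arg (cis t / cis (Arg z))"
  have \<gamma>: "-pi < \<gamma>" "\<gamma> \<le> pi" unfolding \<gamma>_def using Arg_bounded by auto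
  have c\<gamma>: "cis \<gamma> = cis t / cis (Arg z)"
    unfolding \<gamma>_def by (simp add: cis_Arg sgn_div_norm norm_divide)
  define \<beta> where "\<beta> = t - \<gamma>"
  have "cis \<beta> = cis (Arg z)" unfolding \<beta>_def cis_divide[symmetric] c\<gamma> by simp
  then have z_eq: "z = of_real r * cis \<beta>"
    using rcis_cmod_Arg[of z] by (simp add: r_def rcis_def)
  have sq: "(norm (cis s - z))\<^sup>2 = 1 + r\<^sup>2 - 2 * r * cos (s - \<beta>)" for s
    unfolding z_eq by (rule norm_cis_diff_sq)
  have less: "norm (cis s - z) < \<alpha> * (1 - (norm z)\<^sup>2)" if "cos (t - \<beta>) < cos (s - \<beta>)" "r > 0" for s
  proof -
    have "(norm (cis s - z))\<^sup>2 < (norm (cis t - z))\<^sup>2"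
      unfolding sq using that by simp
    then show ?thesis unfolding at[symmetric] by (rule power_less_imp_less_base) simp
  qed
  consider "r = 0 \<or> \<gamma> = 0" | "r > 0" "\<gamma> > 0" | "r > 0" "\<gamma> < 0"
    using r by linarith
  then show ?thesis
  proof cases
    case 1
    then have z2: "z = of_real r * cis t" using z_eq \<beta>_def by auto
    have "cis t - z = of_real (1 - r) * cis t" by (simp add: z2 algebra_simps)
    then have "norm (cis t - z) = 1 - r" using r by (simp add: norm_mult del: of_real_diff)
    then have e: "1 - r = \<alpha> * (1 - r\<^sup>2)" using at by (simp add: r_def)
    then have "(1 - r) * (1 - \<alpha> * (1 + r)) = 0" by (simp add: power2_eq_square algebra_simps)
    then have "\<alpha> * (1 + r) = 1" using r by simp
    moreover from this have "\<alpha> > 0" using r by (intro zero_less_mult_pos2[of \<alpha> "1 + r"]) auto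
    ultimately have "1/\<alpha> - 1 = r" by (simp add: field_simps)
    then show ?thesis using z2 r \<open>\<alpha> > 0\<close> by auto
  next
    case 2
    have "\<forall>s\<in>{t-\<gamma><..<t}. norm (cis s - z) < \<alpha> * (1 - (norm z)\<^sup>2)"
    proof
      fix s assume "s \<in> {t-\<gamma><..<t}"
      then have "cos (t - \<beta>) < cos (s - \<beta>)"
        using \<gamma> by (intro cos_monotone_0_pi) (auto simp: \<beta>_def)
      then show "norm (cis s - z) < \<alpha> * (1 - (norm z)\<^sup>2)" using 2 by (intro less)
    qed
    then show ?thesis using 2 by blast
  next
    case 3
    have "\<forall>s\<in>{t<..<t+(-\<gamma>)}. norm (cis s - z) < \<alpha> * (1 - (norm z)\<^sup>2)"
    proof
      fix s assume "s \<in> {t<..<t+(-\<gamma>)}"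
      then have "cos (-(t - \<beta>)) < cos (-(s - \<beta>))"
        using \<gamma> by (intro cos_monotone_0_pi) (auto simp: \<beta>_def)
      then have "cos (t - \<beta>) < cos (s - \<beta>)" by (simp only: cos_minus)
      then show "norm (cis s - z) < \<alpha> * (1 - (norm z)\<^sup>2)" using 3 by (intro less)
    qed
    then show ?thesis using 3 by (meson neg_0_less_iff_less)
  qed
qed

text \<open>The set is a union of closed arcs of the circle. The open arcs cover all of it except the
  degenerate one-point arcs and countably many endpoints.\<close>

lemma stolz_shadow_measurable:
  assumes B: "B \<in> sets borel" "B \<subseteq> unit_disc"
  shows "{\<zeta>\<in>sphere 0 1. \<exists>z\<in>B. z \<in> stolz_angle \<alpha> \<zeta>} \<in> sets circle_lborel" (is "?U \<in> _")
proof -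
  define V where "V = (\<Union>z\<in>B. {\<zeta>. norm (\<zeta> - z) < \<alpha> * (1 - (norm z)\<^sup>2)})"
  define W where "W = {t. cis t \<in> V}"
  \<comment> \<open>The angles that border an interval of \<open>W\<close> from outside: countably
    many, however large \<open>B\<close> is. By \<open>arc_end\<close> they contain every endpoint
    of a nondegenerate arc that \<open>V\<close> misses.\<close>
  define N where "N = {t. t \<notin> W \<and> (\<exists>e>0. {t<..<t+e} \<subseteq> W)} \<union> {t. t \<notin> W \<and> (\<exists>e>0. {t-e<..<t} \<subseteq> W)}"
  \<comment> \<open>Degenerate arcs occur only for \<open>norm z = 1/\<alpha> - 1\<close>, with
    \<open>z\<close> this multiple of the vertex. Their vertices form the preimage of
    \<open>B\<close> under a scaling, and here \<open>B\<close> being Borel is used.\<close>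
  define D where "D = (if \<alpha> > 0 \<and> 1/\<alpha> - 1 \<ge> 0 then {\<zeta>\<in>sphere 0 1. of_real (1/\<alpha> - 1) * \<zeta> \<in> B} else {})"
  have openV: "open V"
    unfolding V_def by (intro open_UN ballI open_Collect_less continuous_intros)
  have "countable (cis ` N)"
    unfolding N_def by (intro countable_image countable_Un countable_left_gap_ends countable_right_gap_ends)
  \<comment> \<open>A bordering point may or may not belong to \<open>?U\<close>; intersecting keeps
    the set countable and makes the decomposition of \<open>?U\<close> exact.\<close>
  moreover define N' where "N' = ?U \<inter> cis ` N"
  ultimately have "countable N'" by auto
  then have N': "N' \<in> sets borel"
    by (meson sets.countable borel_closed closed_singleton)
  have D: "D \<in> sets borel"
  proof -
    have "(\<lambda>\<zeta>::complex. of_real (1/\<alpha> - 1) * \<zeta>) \<in> borel \<rightarrow>\<^sub>M borel" by measurable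
    from measurable_sets[OF this B(1)]
    have "sphere 0 1 \<inter> ((\<lambda>\<zeta>::complex. of_real (1/\<alpha> - 1) * \<zeta>) -` B) \<in> sets borel" by auto
    also have "sphere 0 1 \<inter> ((\<lambda>\<zeta>::complex. of_real (1/\<alpha> - 1) * \<zeta>) -` B) =
       {\<zeta>\<in>sphere 0 1. of_real (1/\<alpha> - 1) * \<zeta> \<in> B}" by auto
    finally show ?thesis by (simp add: D_def)
  qed
  have "?U = (V \<inter> sphere 0 1) \<union> D \<union> N'"
  proof (intro equalityI subsetI)
    fix \<zeta> assume \<zeta>: "\<zeta> \<in> ?U"
    then obtain z where z: "z \<in> B" "norm (\<zeta> - z) \<le> \<alpha> * (1 - (norm z)\<^sup>2)"
      by (auto simp: stolz_angle_def norm_minus_commute)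
    from \<zeta> have n1: "norm \<zeta> = 1" by simp
    define t where "t = Arg \<zeta>"
    have t: "\<zeta> = cis t" using rcis_cmod_Arg[of \<zeta>] n1 by (simp add: rcis_def t_def)
    show "\<zeta> \<in> (V \<inter> sphere 0 1) \<union> D \<union> N'"
    proof (cases "\<zeta> \<in> V")
      case True then show ?thesis using n1 by auto
    next
      case False
      then have tW: "t \<notin> W" by (simp add: W_def t)
      have "norm (cis t - z) = \<alpha> * (1 - (norm z)\<^sup>2)" using False z by (auto simp: V_def t not_less)
      moreover have "norm z < 1" using z B by auto
      ultimately consider "\<alpha> > 0 \<and> 1/\<alpha> - 1 \<ge> 0 \<and> of_real (1/\<alpha> - 1) * cis t = z"
        | e where "e > 0" "\<forall>s\<in>{t<..<t+e}. norm (cis s - z) < \<alpha> * (1 - (norm z)\<^sup>2)"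
        | e where "e > 0" "\<forall>s\<in>{t-e<..<t}. norm (cis s - z) < \<alpha> * (1 - (norm z)\<^sup>2)"
        using arc_end by blast
      then show ?thesis
      proof cases
        case 1
        then have "\<zeta> \<in> D" using z n1 by (simp add: D_def t)
        then show ?thesis by simp
      next
        case 2
        then have "{t<..<t+e} \<subseteq> W" using z by (auto simp: W_def V_def)
        then have "t \<in> N" using 2 tW by (auto simp: N_def)
        then show ?thesis using \<zeta> t by (auto simp: N'_def)
      next
        case 3
        then have "{t-e<..<t} \<subseteq> W" using z by (auto simp: W_def V_def)
        then have "t \<in> N" using 3 tW by (auto simp: N_def)
        then show ?thesis using \<zeta> t by (auto simp: N'_def)
      qed
    qed
  next
    fix \<zeta> assume "\<zeta> \<in> (V \<inter> sphere 0 1) \<union> D \<union> N'"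
    then consider "\<zeta> \<in> V \<inter> sphere 0 1" | "\<zeta> \<in> D" | "\<zeta> \<in> N'" by blast
    then show "\<zeta> \<in> ?U"
    proof cases
      case 1
      then obtain z where z: "z \<in> B" "norm (\<zeta> - z) < \<alpha> * (1 - (norm z)\<^sup>2)" by (auto simp: V_def)
      have "z \<in> stolz_angle \<alpha> \<zeta>" using z B by (auto simp: stolz_angle_def norm_minus_commute)
      then show ?thesis using 1 z by auto
    next
      case 2
      then have a: "\<alpha> > 0" "1/\<alpha> - 1 \<ge> 0" "norm \<zeta> = 1" and zB: "of_real (1/\<alpha> - 1) * \<zeta> \<in> B"
        by (auto simp: D_def split: if_splits)
      define r where "r = 1/\<alpha> - 1"
      have r: "r \<ge> 0" using a by (simp add: r_def)
      have nz: "norm (of_real r * \<zeta>) = r" using a r by (simp add: norm_mult)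
      have "of_real r * \<zeta> \<in> unit_disc" using zB B unfolding r_def by blast
      then have "r < 1" using nz by simp
      have "norm (of_real r * \<zeta> - \<zeta>) = norm (of_real (r - 1) * \<zeta>)" by (simp add: algebra_simps)
      also have "\<dots> = 1 - r" using a \<open>r < 1\<close> by (simp add: norm_mult del: of_real_diff)
      also have "\<dots> = \<alpha> * (1 - r\<^sup>2)"
      proof -
        have "\<alpha> * (1 + r) = 1" using a by (simp add: r_def)
        then have "\<alpha> * (1 + r) * (1 - r) = 1 - r" by simp
        then show ?thesis by (simp add: power2_eq_square algebra_simps)
      qed
      finally have "of_real r * \<zeta> \<in> stolz_angle \<alpha> \<zeta>"
        using nz \<open>r < 1\<close> by (simp add: stolz_angle_def)
      then show ?thesis using zB a by (auto simp: r_def)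
    next
      case 3 then show ?thesis by (simp add: N'_def)
    qed
  qed
  moreover have "(V \<inter> sphere 0 1) \<union> D \<union> N' \<in> sets borel"
    using openV D N' by (intro sets.Un) auto
  ultimately show ?thesis by (auto simp: sets_circle_lborel_iff)
qed

section \<open>The weak type estimate\<close>

text \<open>A weak form of Jordan's inequality: the Taylor remainder is at most
  \<open>x^3 / 6\<close>, and \<open>x < 2\<close> bounds this by \<open>2 * x / 3\<close>.\<close>

lemma sin_ge_third:
  fixes x :: real
  assumes "0 \<le> x" "x \<le> pi/2"
  shows "x / 3 \<le> sin x"
proof -
  have "\<bar>sin x - (\<Sum>m<3. sin_coeff m * x ^ m)\<bar> \<le> inverse (fact 3) * \<bar>x\<bar> ^ 3"
    by (rule Maclaurin_sin_bound)
  moreover have "(\<Sum>m<3. sin_coeff m * x ^ m) = x"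
    by (simp add: numeral_3_eq_3 sin_coeff_def)
  ultimately have "x - sin x \<le> x ^ 3 / 6"
    using assms by (simp add: fact_numeral abs_if split: if_splits)
  also have "\<dots> = x * x\<^sup>2 / 6" by (simp add: power3_eq_cube power2_eq_square)
  also have "\<dots> \<le> x * 2\<^sup>2 / 6"
    using assms pi_less_4 by (intro divide_right_mono mult_left_mono power_mono) auto
  finally show ?thesis by simp
qed

text \<open>The chord has length \<open>2 * sin (\<bar>t - \<beta>\<bar> / 2)\<close>, which is
  small at both ends of the range of the difference. The second alternative accounts for points on
  opposite sides of the cut at angle 0.\<close>

lemma circle_chord_bound:
  assumes n: "norm (cis t - cis \<beta>) \<le> \<rho>" and u: "\<bar>t - \<beta>\<bar> \<le> 2 * pi"
  shows "\<bar>t - \<beta>\<bar> \<le> 3 * \<rho> \<or> 2 * pi - \<bar>t - \<beta>\<bar> \<le> 3 * \<rho>"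
proof -
  define v where "v = \<bar>t - \<beta>\<bar> / 2"
  have v: "0 \<le> v" "v \<le> pi" using u by (auto simp: v_def)
  have "(norm (cis t - cis \<beta>))\<^sup>2 = 2 - 2 * cos (t - \<beta>)"
    using norm_cis_diff_sq[of t 1 \<beta>] by simp
  also have "cos (t - \<beta>) = cos (2 * v)" by (simp add: v_def abs_if flip: cos_minus[of "t - \<beta>"])
  also have "2 - 2 * cos (2 * v) = (2 * sin v)\<^sup>2" by (simp add: cos_double_sin power_mult_distrib)
  finally have "norm (cis t - cis \<beta>) = 2 * sin v"
    by (rule power2_eq_imp_eq) (use v in \<open>auto simp: sin_ge_zero\<close>)
  then have sv: "2 * sin v \<le> \<rho>" using n by simp
  show ?thesis
  proof (cases "v \<le> pi/2")
    case True
    then have "v / 3 \<le> sin v" using v by (intro sin_ge_third)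
    then show ?thesis using sv by (simp add: v_def)
  next
    case False
    then have "(pi - v) / 3 \<le> sin (pi - v)" using v by (intro sin_ge_third) auto
    then have "pi - v \<le> 3 * sin v" by simp
    then show ?thesis using sv by (simp add: v_def)
  qed
qed

lemma emeasure_circle_cball_le:
  assumes \<zeta>: "norm \<zeta> = 1" and \<rho>: "\<rho> \<ge> 0"
  shows "emeasure circle_lborel (cball \<zeta> \<rho> \<inter> sphere 0 1) \<le> ennreal (5 * \<rho>)"
proof -
  define \<beta> where "\<beta> = Arg2pi \<zeta>"
  have \<beta>: "0 \<le> \<beta>" "\<beta> \<le> 2 * pi" using Arg2pi_ge_0[of \<zeta>] Arg2pi_lt_2pi[of \<zeta>] by (auto simp: \<beta>_def)
  have \<zeta>_eq: "\<zeta> = cis \<beta>" using Arg2pi_eq[of \<zeta>] \<zeta> by (simp add: \<beta>_def cis_conv_exp)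
  \<comment> \<open>The translates by \<open>2 * pi\<close> catch the part of the ball beyond the
    cut. Three intervals of length \<open>6 * \<rho>\<close> give
    \<open>18 * \<rho> / (2 * pi)\<close> after normalization, and \<open>pi \<ge> 2\<close> brings
    this below \<open>5 * \<rho>\<close>.\<close>
  let ?I = "\<lambda>x. {x - 3 * \<rho>..x + 3 * \<rho>}"
  have "{t\<in>{0..2 * pi}. cis t \<in> cball \<zeta> \<rho> \<inter> sphere 0 1} \<subseteq> ?I \<beta> \<union> (?I (\<beta> + 2 * pi) \<union> ?I (\<beta> - 2 * pi))"
  proof
    fix t assume "t \<in> {t\<in>{0..2 * pi}. cis t \<in> cball \<zeta> \<rho> \<inter> sphere 0 1}"
    then have t: "0 \<le> t" "t \<le> 2 * pi" "norm (cis t - cis \<beta>) \<le> \<rho>"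
      by (auto simp: \<zeta>_eq dist_norm norm_minus_commute)
    then have "\<bar>t - \<beta>\<bar> \<le> 3 * \<rho> \<or> 2 * pi - \<bar>t - \<beta>\<bar> \<le> 3 * \<rho>"
      using \<beta> by (intro circle_chord_bound) auto
    then show "t \<in> ?I \<beta> \<union> (?I (\<beta> + 2 * pi) \<union> ?I (\<beta> - 2 * pi))"
      using t \<beta> by (auto simp: abs_if split: if_splits)
  qed
  then have "emeasure lborel {t\<in>{0..2 * pi}. cis t \<in> cball \<zeta> \<rho> \<inter> sphere 0 1} \<le>
      emeasure lborel (?I \<beta> \<union> (?I (\<beta> + 2 * pi) \<union> ?I (\<beta> - 2 * pi)))"
    by (rule emeasure_mono) auto
  also have "\<dots> \<le> emeasure lborel (?I \<beta>) + (emeasure lborel (?I (\<beta> + 2 * pi)) + emeasure lborel (?I (\<beta> - 2 * pi)))"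
    by (intro order.trans[OF emeasure_subadditive] add_left_mono emeasure_subadditive) auto
  also have "\<dots> = ennreal (18 * \<rho>)"
    using \<rho> by (simp flip: ennreal_plus)
  finally have "emeasure circle_lborel (cball \<zeta> \<rho> \<inter> sphere 0 1) \<le> ennreal (18 * \<rho>) / ennreal (2 * pi)"
    by (subst emeasure_circle_lborel) (auto simp: sets_circle_lborel_iff intro!: divide_right_mono_ennreal)
  also have "\<dots> = ennreal (18 * \<rho> / (2 * pi))"
    using \<rho> by (intro divide_ennreal) auto
  also have "\<dots> \<le> ennreal (5 * \<rho>)"
  proof (rule ennreal_leI)
    have "18 * \<rho> \<le> 5 * \<rho> * (2 * pi)"
      using \<rho> mult_left_mono[OF pi_ge_two \<rho>] by (simp add: algebra_simps)
    then show "18 * \<rho> / (2 * pi) \<le> 5 * \<rho>" by (simp add: divide_le_eq mult_ac)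
  qed
  finally show ?thesis .
qed

text \<open>The indicator of the union is at most the number of sets containing the point, and
  Tonelli exchanges the integrals. The sum is written over \<open>count_space I\<close> to match the
  equality that \<open>emeasure_UN_countable\<close> gives for disjoint sets.\<close>

lemma emeasure_UN_countable_le:
  assumes "countable I" "\<And>i. i \<in> I \<Longrightarrow> A i \<in> sets M"
  shows "emeasure M (\<Union>i\<in>I. A i) \<le> (\<integral>\<^sup>+i. emeasure M (A i) \<partial>count_space I)"
proof -
  have [measurable]: "(\<Union>i\<in>I. A i) \<in> sets M" using assms by (intro sets.countable_UN') auto
  have "emeasure M (\<Union>i\<in>I. A i) = (\<integral>\<^sup>+x. indicator (\<Union>i\<in>I. A i) x \<partial>M)" by simp
  also have "\<dots> \<le> (\<integral>\<^sup>+x. (\<integral>\<^sup>+i. indicator (A i) x \<partial>count_space I) \<partial>M)"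
  proof (rule nn_integral_mono)
    fix x
    show "indicator (\<Union>i\<in>I. A i) x \<le> (\<integral>\<^sup>+i. indicator (A i) x \<partial>count_space I)"
    proof (cases "x \<in> (\<Union>i\<in>I. A i)")
      case True
      then obtain j where j: "j \<in> I" "x \<in> A j" by auto
      have "(1::ennreal) = (\<integral>\<^sup>+i. indicator {j} i \<partial>count_space I)" using j by simp
      also have "\<dots> \<le> (\<integral>\<^sup>+i. indicator (A i) x \<partial>count_space I)"
        using j by (intro nn_integral_mono) (auto split: split_indicator)
      finally show ?thesis using True by simp
    qed simp
  qed
  also have "\<dots> = (\<integral>\<^sup>+i. (\<integral>\<^sup>+x. indicator (A i) x \<partial>M) \<partial>count_space I)"
    using assms by (intro nn_integral_count_space_nn_integral) auto
  also have "\<dots> = (\<integral>\<^sup>+i. emeasure M (A i) \<partial>count_space I)"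
    using assms by (intro nn_integral_cong) auto
  finally show ?thesis .
qed

section \<open>Poisson integrals in a Stolz angle and masses of balls around the vertex\<close>

lemma poisson_kernel_nonneg: "norm z < 1 \<Longrightarrow> 0 \<le> poisson_kernel z \<eta>"
  by (simp add: poisson_kernel_def abs_square_le_1)

lemma poisson_kernel_measurable [measurable]: "poisson_kernel z \<in> borel_measurable borel"
  unfolding poisson_kernel_def by measurable

lemma poisson_kernel_circle_measurable:
  "sets \<mu> = sets circle_lborel \<Longrightarrow> poisson_kernel z \<in> borel_measurable \<mu>"
  by (simp add: sets_circle_lborel measurable_restrict_space1 cong: measurable_cong_sets)

text \<open>In the Stolz angle the triangle inequality and \<open>d \<le> norm (\<eta> - z)\<close>
  give \<open>dist \<zeta> \<eta> \<le> A * norm (\<eta> - z)\<close> with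
  \<open>A = 1 + 2 * \<bar>\<alpha>\<bar>\<close>. So at distance about \<open>2 ^ k * d\<close>
  from the vertex the kernel is at most a multiple of \<open>1 / (d * 4 ^ k)\<close>. The 8 is a 2
  from \<open>1 - (norm z)^2 \<le> 2 * d\<close> times a 4 from squaring a dyadic factor 2.\<close>

lemma poisson_kernel_dyadic:
  assumes z: "z \<in> stolz_angle \<alpha> \<zeta>" and \<zeta>: "norm \<zeta> = 1" and \<eta>: "norm \<eta> = 1"
  defines "d \<equiv> 1 - norm z"
  shows "ennreal (poisson_kernel z \<eta>) \<le>
    (\<Sum>k. ennreal (8 * (1 + 2 * \<bar>\<alpha>\<bar>)\<^sup>2 / d * (1/4) ^ k) * indicator (cball \<zeta> (2 ^ k * d)) \<eta>)"
proof -
  define A where "A = 1 + 2 * \<bar>\<alpha>\<bar>"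
  have A: "A \<ge> 1" by (simp add: A_def)
  have nz: "norm z < 1" and dist: "norm (z - \<zeta>) \<le> \<alpha> * (1 - (norm z)\<^sup>2)"
    using z by (auto simp: stolz_angle_def)
  have d: "d > 0" "d \<le> 1" using nz by (auto simp: d_def)
  have fac: "1 - (norm z)\<^sup>2 = d * (1 + norm z)" by (simp add: d_def power2_eq_square algebra_simps)
  then have fac2: "0 \<le> 1 - (norm z)\<^sup>2" "1 - (norm z)\<^sup>2 \<le> 2 * d" using d nz by simp_all
  have "norm \<eta> \<le> norm (\<eta> - z) + norm z" by norm
  then have \<eta>z: "d \<le> norm (\<eta> - z)" using \<eta> by (simp add: d_def)
  have "\<alpha> * (1 - (norm z)\<^sup>2) \<le> \<bar>\<alpha>\<bar> * (2 * d)"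
    using fac2 d by (intro mult_mono) auto
  also have "\<dots> \<le> \<bar>\<alpha>\<bar> * (2 * norm (\<eta> - z))" using \<eta>z by (intro mult_left_mono) auto
  finally have "norm (z - \<zeta>) \<le> 2 * \<bar>\<alpha>\<bar> * norm (\<eta> - z)" using dist by simp
  moreover have "dist \<zeta> \<eta> \<le> norm (\<eta> - z) + norm (z - \<zeta>)" unfolding dist_norm by norm
  ultimately have \<eta>\<zeta>: "dist \<zeta> \<eta> \<le> A * norm (\<eta> - z)" by (simp add: A_def algebra_simps)
  have "\<exists>k. dist \<zeta> \<eta> \<le> 2 ^ k * d"
  proof -
    obtain k where "dist \<zeta> \<eta> / d < 2 ^ k" using real_arch_pow[of 2 "dist \<zeta> \<eta> / d"] by auto
    then show ?thesis using d by (intro exI[of _ k]) (simp add: field_simps)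
  qed
  \<comment> \<open>One term of the series is enough, that of the smallest ball containing
    \<open>\<eta>\<close>. The previous ball misses \<open>\<eta>\<close>, which costs a factor 2;
    for \<open>k = 0\<close> the bound \<open>d \<le> norm (\<eta> - z)\<close> takes its
    place.\<close>
  then obtain k where k: "dist \<zeta> \<eta> \<le> 2 ^ k * d" and k_least: "\<And>m. m < k \<Longrightarrow> \<not> dist \<zeta> \<eta> \<le> 2 ^ m * d"
    using exists_least_iff[of "\<lambda>k. dist \<zeta> \<eta> \<le> 2 ^ k * d"] by blast
  have "2 ^ k * d \<le> 2 * A * norm (\<eta> - z)"
  proof (cases k)
    case 0
    have "d * 1 \<le> norm (\<eta> - z) * (2 * A)" using \<eta>z d A by (intro mult_mono) auto
    then show ?thesis using 0 by (simp add: mult_ac)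
  next
    case (Suc m)
    then have "2 ^ m * d < dist \<zeta> \<eta>" using k_least[of m] by simp
    then show ?thesis using \<eta>\<zeta> Suc by simp
  qed
  then have "(2 ^ k * d)\<^sup>2 \<le> (2 * A * norm (\<eta> - z))\<^sup>2" using d by (intro power_mono) auto
  then have sq: "4 ^ k * d\<^sup>2 \<le> 4 * A\<^sup>2 * (norm (\<eta> - z))\<^sup>2"
    by (simp add: power_mult_distrib power2_eq_square[of "2 ^ k :: real"] flip: power_mult_distrib[of 2 2 k])
  have pos: "0 < (norm (\<eta> - z))\<^sup>2" using \<eta>z d by (intro zero_less_power) auto
  have "poisson_kernel z \<eta> \<le> 2 * d / (norm (\<eta> - z))\<^sup>2"
    unfolding poisson_kernel_def using fac2 by (intro divide_right_mono) auto
  also have "\<dots> \<le> 8 * A\<^sup>2 / d * (1/4) ^ k"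
  proof -
    have "2 * d * (d * 4 ^ k) = 2 * (4 ^ k * d\<^sup>2)" by (simp add: power2_eq_square)
    also have "\<dots> \<le> 2 * (4 * A\<^sup>2 * (norm (\<eta> - z))\<^sup>2)" by (intro mult_left_mono sq) simp
    finally have "2 * d * (d * 4 ^ k) \<le> 8 * A\<^sup>2 * (norm (\<eta> - z))\<^sup>2" by simp
    then have "2 * d / (norm (\<eta> - z))\<^sup>2 \<le> 8 * A\<^sup>2 / (d * 4 ^ k)"
      using pos d by (subst frac_le_eq) (auto simp: divide_le_0_iff mult_ac)
    then show ?thesis by (simp add: power_one_over)
  qed
  finally have "ennreal (poisson_kernel z \<eta>) \<le> ennreal (8 * A\<^sup>2 / d * (1/4) ^ k) * indicator (cball \<zeta> (2 ^ k * d)) \<eta>"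
    using k by (simp add: ennreal_leI)
  also have "\<dots> = (\<Sum>j\<in>{k}. ennreal (8 * A\<^sup>2 / d * (1/4) ^ j) * indicator (cball \<zeta> (2 ^ j * d)) \<eta>)"
    by (simp only: sum.insert_if finite.emptyI sum.empty empty_iff if_False add_0_right)
  also have "\<dots> \<le> (\<Sum>j. ennreal (8 * A\<^sup>2 / d * (1/4) ^ j) * indicator (cball \<zeta> (2 ^ j * d)) \<eta>)"
    by (intro sum_le_suminf) auto
  finally show ?thesis by (simp add: A_def)
qed

lemma circle_space: "sets \<mu> = sets circle_lborel \<Longrightarrow> space \<mu> = sphere 0 1"
  by (drule sets_eq_imp_space_eq) simp

text \<open>Here \<open>\<kappa>\<close> bounds the maximal function of \<open>\<mu>\<close> at
  \<open>\<zeta>\<close>. The kernel decays like \<open>(1/4) ^ k\<close> while the mass of the ball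
  at scale \<open>2 ^ k * d\<close> grows at most like \<open>2 ^ k\<close>; the resulting geometric
  series has sum 2, which turns 8 into 16.\<close>

lemma nn_poisson_le_maximal:
  assumes sets: "sets \<mu> = sets circle_lborel" and z: "z \<in> stolz_angle \<alpha> \<zeta>" and \<zeta>: "norm \<zeta> = 1"
    and \<kappa>: "0 \<le> \<kappa>"
    and small: "\<And>\<rho>. 0 < \<rho> \<Longrightarrow> \<rho> \<le> 2 \<Longrightarrow> emeasure \<mu> (cball \<zeta> \<rho> \<inter> sphere 0 1) \<le> ennreal (\<kappa> * \<rho>)"
  shows "(\<integral>\<^sup>+\<eta>. ennreal (poisson_kernel z \<eta>) \<partial>\<mu>) \<le> ennreal (16 * (1 + 2 * \<bar>\<alpha>\<bar>)\<^sup>2 * \<kappa>)"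
proof -
  define A where "A = 1 + 2 * \<bar>\<alpha>\<bar>"
  define d where "d = 1 - norm z"
  have d: "d > 0" using z by (auto simp: d_def stolz_angle_def)
  have space: "space \<mu> = sphere 0 1" by (rule circle_space[OF sets])
  have cb: "cball \<zeta> \<rho> \<inter> sphere 0 1 \<in> sets \<mu>" for \<rho>
    by (simp add: sets sets_circle_lborel_iff)
  \<comment> \<open>The circle has diameter 2, so larger radii add no mass. Bounded radii in the
    hypothesis are what Vitali's lemma will ask for.\<close>
  have bound: "emeasure \<mu> (cball \<zeta> \<rho> \<inter> sphere 0 1) \<le> ennreal (\<kappa> * \<rho>)" if "\<rho> > 0" for \<rho>
  proof (cases "\<rho> \<le> 2")
    case False
    have "cball \<zeta> \<rho> \<inter> sphere 0 1 \<subseteq> cball \<zeta> 2 \<inter> sphere 0 1"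
    proof
      fix x assume x: "x \<in> cball \<zeta> \<rho> \<inter> sphere 0 1"
      have "norm (\<zeta> - x) \<le> norm \<zeta> + norm x" by norm
      then show "x \<in> cball \<zeta> 2 \<inter> sphere 0 1" using x \<zeta> by (simp add: dist_norm)
    qed
    then have "emeasure \<mu> (cball \<zeta> \<rho> \<inter> sphere 0 1) \<le> emeasure \<mu> (cball \<zeta> 2 \<inter> sphere 0 1)"
      by (rule emeasure_mono) (rule cb)
    also have "\<dots> \<le> ennreal (\<kappa> * 2)" by (rule small) auto
    also have "\<dots> \<le> ennreal (\<kappa> * \<rho>)" using False \<kappa> by (intro ennreal_leI mult_left_mono) auto
    finally show ?thesis .
  qed (use that small in auto)
  have "(\<integral>\<^sup>+\<eta>. ennreal (poisson_kernel z \<eta>) \<partial>\<mu>) \<le>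
      (\<integral>\<^sup>+\<eta>. (\<Sum>k. ennreal (8 * A\<^sup>2 / d * (1/4) ^ k) * indicator (cball \<zeta> (2 ^ k * d) \<inter> sphere 0 1) \<eta>) \<partial>\<mu>)"
  proof (rule nn_integral_mono)
    fix \<eta> assume "\<eta> \<in> space \<mu>"
    then have \<eta>: "norm \<eta> = 1" by (simp add: space)
    show "ennreal (poisson_kernel z \<eta>) \<le>
      (\<Sum>k. ennreal (8 * A\<^sup>2 / d * (1/4) ^ k) * indicator (cball \<zeta> (2 ^ k * d) \<inter> sphere 0 1) \<eta>)"
      using poisson_kernel_dyadic[OF z \<zeta> \<eta>] \<eta> by (simp add: A_def d_def indicator_inter_arith)
  qed
  also have "\<dots> = (\<Sum>k. ennreal (8 * A\<^sup>2 / d * (1/4) ^ k) * emeasure \<mu> (cball \<zeta> (2 ^ k * d) \<inter> sphere 0 1))"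
    using cb by (simp add: nn_integral_suminf nn_integral_cmult_indicator)
  also have "\<dots> \<le> (\<Sum>k. ennreal (8 * A\<^sup>2 * \<kappa> * (1/2) ^ k))"
  proof (intro suminf_le allI)
    fix k
    have "ennreal (8 * A\<^sup>2 / d * (1/4) ^ k) * emeasure \<mu> (cball \<zeta> (2 ^ k * d) \<inter> sphere 0 1)
       \<le> ennreal (8 * A\<^sup>2 / d * (1/4) ^ k) * ennreal (\<kappa> * (2 ^ k * d))"
      using d by (intro mult_left_mono bound) auto
    also have "\<dots> = ennreal (8 * A\<^sup>2 / d * (1/4) ^ k * (\<kappa> * (2 ^ k * d)))"
      using d \<kappa> by (intro ennreal_mult[symmetric]) auto
    also have "8 * A\<^sup>2 / d * (1/4) ^ k * (\<kappa> * (2 ^ k * d)) = 8 * A\<^sup>2 * \<kappa> * ((1/4) ^ k * 2 ^ k)"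
      using d by simp
    also have "(1/4) ^ k * 2 ^ k = (1/2 :: real) ^ k" by (simp flip: power_mult_distrib)
    finally show "ennreal (8 * A\<^sup>2 / d * (1/4) ^ k) * emeasure \<mu> (cball \<zeta> (2 ^ k * d) \<inter> sphere 0 1)
       \<le> ennreal (8 * A\<^sup>2 * \<kappa> * (1/2) ^ k)" .
  qed auto
  also have "\<dots> = ennreal (8 * A\<^sup>2 * \<kappa> * 2)"
  proof (rule suminf_ennreal_eq)
    show "(\<lambda>k. 8 * A\<^sup>2 * \<kappa> * (1/2) ^ k) sums (8 * A\<^sup>2 * \<kappa> * 2)"
      using geometric_sums[of "1/2::real"] by (intro sums_mult) simp
  qed (use \<kappa> in auto)
  also have "8 * A\<^sup>2 * \<kappa> * 2 = 16 * A\<^sup>2 * \<kappa>" by simp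
  finally show ?thesis unfolding A_def .
qed

text \<open>Weak type (1,1) estimate: where the Poisson integral exceeds \<open>t\<close> inside the Stolz angle, some
  ball around the vertex has \<open>\<mu>\<close>-mass comparable to \<open>t\<close> times its radius; Vitali's covering lemma in
  the plane selects disjoint ones.\<close>

lemma emeasure_nt_poisson_le:
  assumes sets: "sets \<mu> = sets circle_lborel" and t: "t > 0" and E: "E \<in> sets circle_lborel"
    and big: "\<And>\<zeta>. \<zeta> \<in> E \<Longrightarrow> \<exists>z\<in>stolz_angle \<alpha> \<zeta>. ennreal t < (\<integral>\<^sup>+\<eta>. ennreal (poisson_kernel z \<eta>) \<partial>\<mu>)"
  shows "ennreal t * emeasure circle_lborel E \<le> ennreal (400 * (1 + 2 * \<bar>\<alpha>\<bar>)\<^sup>2) * emeasure \<mu> (sphere 0 1)"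
proof -
  define A where "A = 1 + 2 * \<bar>\<alpha>\<bar>"
  have A: "A \<ge> 1" by (simp add: A_def)
  \<comment> \<open>Chosen so that the bound of \<open>nn_poisson_le_maximal\<close> equals
    \<open>t\<close>: if all balls around a point of \<open>E\<close> had mass at most
    \<open>\<kappa> * \<rho>\<close>, the Poisson integral could not exceed \<open>t\<close> in its
    Stolz angle.\<close>
  define \<kappa> where "\<kappa> = t / (16 * A\<^sup>2)"
  have \<kappa>: "\<kappa> > 0" using t A by (simp add: \<kappa>_def)
  have \<kappa>A: "16 * A\<^sup>2 * \<kappa> = t" using A by (simp add: \<kappa>_def)
  have space: "space \<mu> = sphere 0 1" by (rule circle_space[OF sets])
  have E_sub: "E \<subseteq> sphere 0 1" using E by (simp add: sets_circle_lborel_iff)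
  have cb: "cball \<zeta> \<rho> \<inter> sphere 0 1 \<in> sets circle_lborel" for \<zeta> :: complex and \<rho>
    by (simp add: sets_circle_lborel_iff)
  have "\<forall>\<zeta>\<in>E. \<exists>\<rho>. 0 < \<rho> \<and> \<rho> \<le> 2 \<and> ennreal (\<kappa> * \<rho>) < emeasure \<mu> (cball \<zeta> \<rho> \<inter> sphere 0 1)"
  proof (rule ballI, rule ccontr)
    fix \<zeta> assume \<zeta>: "\<zeta> \<in> E" and
      no: "\<not> (\<exists>\<rho>. 0 < \<rho> \<and> \<rho> \<le> 2 \<and> ennreal (\<kappa> * \<rho>) < emeasure \<mu> (cball \<zeta> \<rho> \<inter> sphere 0 1))"
    obtain z where z: "z \<in> stolz_angle \<alpha> \<zeta>" "ennreal t < (\<integral>\<^sup>+\<eta>. ennreal (poisson_kernel z \<eta>) \<partial>\<mu>)"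
      using big[OF \<zeta>] by blast
    have "(\<integral>\<^sup>+\<eta>. ennreal (poisson_kernel z \<eta>) \<partial>\<mu>) \<le> ennreal (16 * (1 + 2 * \<bar>\<alpha>\<bar>)\<^sup>2 * \<kappa>)"
      using no \<kappa> E_sub \<zeta> by (intro nn_poisson_le_maximal[OF sets z(1)]) (auto simp: not_less)
    also have "16 * (1 + 2 * \<bar>\<alpha>\<bar>)\<^sup>2 * \<kappa> = t" using \<kappa>A by (simp only: A_def)
    finally show False using z(2) by simp
  qed
  from bchoice[OF this] obtain r where
    r: "\<forall>\<zeta>\<in>E. 0 < r \<zeta> \<and> r \<zeta> \<le> 2 \<and> ennreal (\<kappa> * r \<zeta>) < emeasure \<mu> (cball \<zeta> (r \<zeta>) \<inter> sphere 0 1)" ..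
  have "E \<subseteq> (\<Union>\<zeta>\<in>E. cball \<zeta> (r \<zeta>))" using r by force
  then obtain C where C: "countable C" "C \<subseteq> E"
    and disj: "pairwise (\<lambda>i j. disjnt (cball i (r i)) (cball j (r j))) C"
    and cover: "E \<subseteq> (\<Union>\<zeta>\<in>C. cball \<zeta> (5 * r \<zeta>))"
    by (rule Vitali_covering_lemma_cballs[where a="\<lambda>\<zeta>. \<zeta>" and B=2]) (use r in auto)
  have "E \<subseteq> (\<Union>\<zeta>\<in>C. cball \<zeta> (5 * r \<zeta>) \<inter> sphere 0 1)" using cover E_sub by blast
  then have "emeasure circle_lborel E \<le> emeasure circle_lborel (\<Union>\<zeta>\<in>C. cball \<zeta> (5 * r \<zeta>) \<inter> sphere 0 1)"
    by (rule emeasure_mono) (rule sets.countable_UN'[OF C(1)], use cb in blast)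
  also have "\<dots> \<le> (\<integral>\<^sup>+\<zeta>. emeasure circle_lborel (cball \<zeta> (5 * r \<zeta>) \<inter> sphere 0 1) \<partial>count_space C)"
    by (intro emeasure_UN_countable_le C cb)
  also have "\<dots> \<le> (\<integral>\<^sup>+\<zeta>. ennreal (25 / \<kappa>) * emeasure \<mu> (cball \<zeta> (r \<zeta>) \<inter> sphere 0 1) \<partial>count_space C)"
  proof (rule nn_integral_mono)
    fix \<zeta> assume "\<zeta> \<in> space (count_space C)"
    then have \<zeta>: "\<zeta> \<in> E" using C by auto
    then have r\<zeta>: "0 < r \<zeta>" "ennreal (\<kappa> * r \<zeta>) \<le> emeasure \<mu> (cball \<zeta> (r \<zeta>) \<inter> sphere 0 1)"
      using r by (auto intro: less_imp_le)
    \<comment> \<open>One factor 5 comes from the enlarged balls of Vitali's lemma, the other from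
      \<open>emeasure_circle_cball_le\<close>; with the \<open>16 * A^2\<close> in
      \<open>\<kappa>\<close> they make up \<open>400 * A^2\<close>.\<close>
    have "emeasure circle_lborel (cball \<zeta> (5 * r \<zeta>) \<inter> sphere 0 1) \<le> ennreal (5 * (5 * r \<zeta>))"
      using \<zeta> E_sub r\<zeta> by (intro emeasure_circle_cball_le) auto
    also have "5 * (5 * r \<zeta>) = 25 / \<kappa> * (\<kappa> * r \<zeta>)" using \<kappa> by simp
    also have "ennreal (25 / \<kappa> * (\<kappa> * r \<zeta>)) = ennreal (25 / \<kappa>) * ennreal (\<kappa> * r \<zeta>)"
      using \<kappa> r\<zeta> by (intro ennreal_mult) auto
    also have "\<dots> \<le> ennreal (25 / \<kappa>) * emeasure \<mu> (cball \<zeta> (r \<zeta>) \<inter> sphere 0 1)"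
      by (intro mult_left_mono r\<zeta>) auto
    finally show "emeasure circle_lborel (cball \<zeta> (5 * r \<zeta>) \<inter> sphere 0 1) \<le>
       ennreal (25 / \<kappa>) * emeasure \<mu> (cball \<zeta> (r \<zeta>) \<inter> sphere 0 1)" .
  qed
  also have "\<dots> = ennreal (25 / \<kappa>) * (\<integral>\<^sup>+\<zeta>. emeasure \<mu> (cball \<zeta> (r \<zeta>) \<inter> sphere 0 1) \<partial>count_space C)"
    by (intro nn_integral_cmult) auto
  also have "(\<integral>\<^sup>+\<zeta>. emeasure \<mu> (cball \<zeta> (r \<zeta>) \<inter> sphere 0 1) \<partial>count_space C) =
      emeasure \<mu> (\<Union>\<zeta>\<in>C. cball \<zeta> (r \<zeta>) \<inter> sphere 0 1)"
    using disj cb C sets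
    by (intro emeasure_UN_countable[symmetric])
       (auto simp: disjoint_family_on_def pairwise_def disjnt_def)
  also have "ennreal (25 / \<kappa>) * \<dots> \<le> ennreal (25 / \<kappa>) * emeasure \<mu> (sphere 0 1)"
    using space by (intro mult_left_mono emeasure_mono) (auto simp: sets sets_circle_lborel_iff)
  finally have "ennreal t * emeasure circle_lborel E \<le> ennreal t * (ennreal (25 / \<kappa>) * emeasure \<mu> (sphere 0 1))"
    by (intro mult_left_mono) auto
  also have "\<dots> = ennreal (t * (25 / \<kappa>)) * emeasure \<mu> (sphere 0 1)"
    using t \<kappa> by (subst ennreal_mult) (auto simp: mult.assoc)
  also have "t * (25 / \<kappa>) = 400 * A\<^sup>2" using \<kappa> by (simp flip: \<kappa>A)
  finally show ?thesis by (simp add: A_def)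
qed

section \<open>Poisson integrals and harmonic functions\<close>

text \<open>Cauchy's formula for \<open>G\<close>, which carries the extra factor
  \<open>(1 - (norm z)^2) / (1 - cnj z * w)\<close>. The factor equals 1 at \<open>w = z\<close>,
  and since \<open>c * cnj c = 1\<close> on the circle it turns the Cauchy kernel there into the
  Poisson kernel.\<close>

lemma poisson_formula:
  assumes F: "F holomorphic_on cball 0 1" and z: "norm z < 1"
  shows "((\<lambda>t. of_real (poisson_kernel z (cis t)) * F (cis t)) has_integral (2 * of_real pi * F z)) {0..2 * pi}"
proof -
  define G where "G = (\<lambda>w. F w * of_real (1 - (norm z)\<^sup>2) / (1 - cnj z * w))"
  have zz: "cnj z * z = of_real ((norm z)\<^sup>2)"
    using complex_norm_square[of z] by (simp add: mult.commute)
  have sq1: "(norm z)\<^sup>2 < 1" using z by (simp add: abs_square_less_1)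
  have nz: "1 - cnj z * w \<noteq> 0" if "norm w \<le> 1" for w
  proof
    assume "1 - cnj z * w = 0"
    then have "norm (cnj z * w) = 1" by simp
    moreover have "norm (cnj z * w) \<le> norm z * 1"
      unfolding norm_mult complex_mod_cnj using that by (intro mult_left_mono) auto
    ultimately show False using z by simp
  qed
  have "G holomorphic_on cball 0 1"
    unfolding G_def by (intro holomorphic_intros F) (use nz in auto)
  from Cauchy_integral_circlepath_simple[OF this, of z] z
  have "((\<lambda>u. G u / (u - z)) has_contour_integral (2 * of_real pi * \<i> * G z)) (part_circlepath 0 1 0 (2 * pi))"
    by (simp add: circlepath_def)
  then have "((\<lambda>t. G (cis t) / (cis t - z) * \<i> * cis t) has_integral (2 * of_real pi * \<i> * G z)) {0..2 * pi}"
    by (simp add: has_contour_integral_part_circlepath_iff)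
  from has_integral_mult_right[OF this, of "- \<i>"]
  have "((\<lambda>t. - \<i> * (G (cis t) / (cis t - z) * \<i> * cis t)) has_integral (2 * of_real pi * G z)) {0..2 * pi}"
    by (simp add: mult_ac flip: mult.assoc[of \<i> \<i>])
  moreover have "G z = F z"
  proof -
    have "1 - (norm z)\<^sup>2 \<noteq> 0" using sq1 by simp
    then have "of_real (1 - (norm z)\<^sup>2) \<noteq> (0::complex)" by (simp only: of_real_eq_0_iff not_False_eq_True)
    moreover have "1 - cnj z * z = of_real (1 - (norm z)\<^sup>2)" by (simp add: zz)
    ultimately show ?thesis unfolding G_def by (simp only: nonzero_mult_div_cancel_right not_False_eq_True)
  qed
  moreover have "- \<i> * (G c / (c - z) * \<i> * c) = of_real (poisson_kernel z c) * F c" if c: "norm c = 1" for c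
  proof -
    have cc: "c * cnj c = 1" using c complex_norm_square[of c] by simp
    have "of_real ((norm (c - z))\<^sup>2) = (c - z) * cnj (c - z)" using complex_norm_square[of "c - z"] by simp
    then have "c * of_real ((norm (c - z))\<^sup>2) = (c - z) * (c * cnj c - cnj z * c)"
      by (simp only: complex_cnj_diff) (simp only: algebra_simps)
    then have eq: "c * of_real ((norm (c - z))\<^sup>2) = (c - z) * (1 - cnj z * c)"
      by (simp only: cc)
    have n1: "1 - cnj z * c \<noteq> 0" using nz c by simp
    have n2: "c - z \<noteq> 0" using c z by auto
    have n3: "c \<noteq> 0" using c by auto
    have "- \<i> * (G c / (c - z) * \<i> * c) = G c / (c - z) * c"
      by (simp add: mult_ac flip: mult.assoc[of \<i> \<i>])
    also have "\<dots> = F c * of_real (1 - (norm z)\<^sup>2) * c / ((c - z) * (1 - cnj z * c))"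
      by (simp add: G_def mult_ac)
    also have "\<dots> = F c * of_real (1 - (norm z)\<^sup>2) * c / (c * of_real ((norm (c - z))\<^sup>2))"
      by (simp only: eq)
    also have "\<dots> = of_real (poisson_kernel z c) * F c"
      using n3 by (simp add: poisson_kernel_def mult_ac)
    finally show ?thesis .
  qed
  ultimately show ?thesis by simp
qed

text \<open>Nonnegativity on the circle allows the gauge integral over the angle to be read as an
  integral in \<open>ennreal\<close>; its \<open>2 * pi\<close> cancels against the normalization of
  the measure.\<close>

lemma nn_poisson_formula:
  assumes F: "F holomorphic_on cball 0 1" and z: "norm z < 1"
    and nonneg: "\<And>\<eta>. norm \<eta> = 1 \<Longrightarrow> 0 \<le> Re (F \<eta>)"
  shows "(\<integral>\<^sup>+\<eta>. ennreal (poisson_kernel z \<eta>) * ennreal (Re (F \<eta>)) \<partial>circle_lborel) = ennreal (Re (F z))"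
proof -
  have "(Re \<circ> (\<lambda>t. of_real (poisson_kernel z (cis t)) * F (cis t)) has_integral Re (2 * of_real pi * F z)) {0..2 * pi}"
    by (intro has_integral_linear[OF poisson_formula[OF F z]] bounded_linear_Re)
  then have I: "((\<lambda>t. poisson_kernel z (cis t) * Re (F (cis t))) has_integral (2 * pi * Re (F z))) {0..2 * pi}"
    by (simp add: o_def)
  have pos: "0 \<le> poisson_kernel z (cis t) * Re (F (cis t))" for t
    using poisson_kernel_nonneg[OF z] nonneg by simp
  have "0 \<le> 2 * pi * Re (F z)" by (rule has_integral_nonneg[OF I pos])
  then have Fz: "0 \<le> Re (F z)" using mult_pos_neg[of "2 * pi" "Re (F z)"] by (intro leI) auto
  have "continuous_on (sphere 0 1) (\<lambda>\<eta>. Re (F \<eta>))"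
    by (intro continuous_intros continuous_on_subset[OF holomorphic_on_imp_continuous_on[OF F]]) auto
  then have [measurable]: "(\<lambda>\<eta>. Re (F \<eta>)) \<in> borel_measurable circle_lborel"
    by (simp add: borel_measurable_continuous_on_restrict sets_circle_lborel cong: measurable_cong_sets)
  have [measurable]: "poisson_kernel z \<in> borel_measurable circle_lborel"
    by (rule poisson_kernel_circle_measurable) simp
  have "(\<integral>\<^sup>+\<eta>. ennreal (poisson_kernel z \<eta>) * ennreal (Re (F \<eta>)) \<partial>circle_lborel) =
    (\<integral>\<^sup>+t. ennreal (poisson_kernel z (cis t)) * ennreal (Re (F (cis t))) * indicator {0..2 * pi} t \<partial>lborel) / ennreal (2 * pi)"
    by (rule nn_integral_circle_lborel) measurable
  also have "(\<integral>\<^sup>+t. ennreal (poisson_kernel z (cis t)) * ennreal (Re (F (cis t))) * indicator {0..2 * pi} t \<partial>lborel) =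
     (\<integral>\<^sup>+t. ennreal (indicator {0..2 * pi} t * (poisson_kernel z (cis t) * Re (F (cis t)))) \<partial>lborel)"
    using poisson_kernel_nonneg[OF z] nonneg
    by (intro nn_integral_cong) (auto simp: ennreal_mult split: split_indicator)
  also have "\<dots> = ennreal (2 * pi * Re (F z))"
    by (rule nn_integral_has_integral_lebesgue[OF pos I])
  also have "\<dots> / ennreal (2 * pi) = ennreal (Re (F z))"
    using Fz by (subst divide_ennreal) auto
  finally show ?thesis .
qed

section \<open>Harmonic functions on the disc and real parts of holomorphic functions\<close>

lemma has_real_derivative_along_line:
  fixes h :: "complex \<Rightarrow> real"
  assumes "(h has_derivative (\<lambda>v. a * Re v + b * Im v)) (at (w + of_real u * e))"
  shows "((\<lambda>u. h (w + of_real u * e)) has_real_derivative (a * Re e + b * Im e)) (at u)"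
proof -
  have "((\<lambda>u. w + of_real u * e) has_derivative (\<lambda>v. of_real v * e)) (at u)"
    by (auto intro!: derivative_eq_intros)
  from has_derivative_compose[OF this assms]
  have "((\<lambda>u. h (w + of_real u * e)) has_derivative (\<lambda>v. a * Re (of_real v * e) + b * Im (of_real v * e))) (at u)" .
  moreover have "(\<lambda>v. a * Re (of_real v * e) + b * Im (of_real v * e)) = (*) (a * Re e + b * Im e)"
    by (auto simp: algebra_simps)
  ultimately show ?thesis by (simp add: has_field_derivative_def)
qed

text \<open>The mean value theorem is used twice, along \<open>e1\<close>, where \<open>k\<close> is
  the directional derivative of \<open>h\<close>, and then along \<open>e2\<close>. The second
  difference is symmetric in \<open>e1\<close> and \<open>e2\<close> while the right-hand side is
  not, which is how mixed partials get compared.\<close>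

lemma second_difference_mvt:
  fixes h k :: "complex \<Rightarrow> real"
  assumes s: "s > 0" and e: "norm e1 = 1" "norm e2 = 1"
    and h: "\<And>w. w \<in> cball z (2 * s) \<Longrightarrow> (h has_derivative (\<lambda>v. a w * Re v + b w * Im v)) (at w)"
    and k: "\<And>w. w \<in> cball z (2 * s) \<Longrightarrow> (k has_derivative (\<lambda>v. c w * Re v + d w * Im v)) (at w)"
    and k_eq: "\<And>w. k w = a w * Re e1 + b w * Im e1"
  obtains p where "p \<in> cball z (2 * s)"
    "h (z + of_real s * e1 + of_real s * e2) - h (z + of_real s * e1) - h (z + of_real s * e2) + h z =
       s * s * (c p * Re e2 + d p * Im e2)"
proof -
  have mem: "z + of_real u * e1 + of_real v * e2 \<in> cball z (2 * s)" if "0 \<le> u" "u \<le> s" "0 \<le> v" "v \<le> s" for u v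
  proof -
    have "norm (of_real u * e1 + of_real v * e2) \<le> norm (of_real u * e1) + norm (of_real v * e2)"
      by (rule norm_triangle_ineq)
    also have "\<dots> \<le> 2 * s" using that e by (simp add: norm_mult)
    finally have "dist (z + (of_real u * e1 + of_real v * e2)) z \<le> 2 * s" by (simp only: dist_norm add_diff_cancel_left')
    then show ?thesis by (simp only: mem_cball dist_commute add.assoc)
  qed
  define \<phi> where "\<phi> = (\<lambda>u. h (z + of_real s * e2 + of_real u * e1) - h (z + of_real u * e1))"
  have "\<exists>u. 0 < u \<and> u < s \<and> \<phi> s - \<phi> 0 = (s - 0) * (k (z + of_real s * e2 + of_real u * e1) - k (z + of_real u * e1))"
  proof (rule MVT2[OF s])
    fix u assume u: "0 \<le> u" "u \<le> s"
    have "z + of_real s * e2 + of_real u * e1 \<in> cball z (2 * s)" "z + of_real u * e1 \<in> cball z (2 * s)"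
      using mem[of u s] mem[of u 0] u s by (simp_all add: add_ac)
    then show "(\<phi> has_real_derivative k (z + of_real s * e2 + of_real u * e1) - k (z + of_real u * e1)) (at u)"
      unfolding \<phi>_def k_eq by (intro DERIV_diff has_real_derivative_along_line h)
  qed
  then obtain u where u: "0 < u" "u < s"
    and eq: "\<phi> s - \<phi> 0 = s * (k (z + of_real s * e2 + of_real u * e1) - k (z + of_real u * e1))" by auto
  have "\<exists>v. 0 < v \<and> v < s \<and> k (z + of_real u * e1 + of_real s * e2) - k (z + of_real u * e1 + of_real 0 * e2) =
     (s - 0) * (c (z + of_real u * e1 + of_real v * e2) * Re e2 + d (z + of_real u * e1 + of_real v * e2) * Im e2)"
    by (rule MVT2[OF s]) (intro has_real_derivative_along_line k mem; use u in simp)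
  then obtain v where v: "0 < v" "v < s"
    and eq2: "k (z + of_real u * e1 + of_real s * e2) - k (z + of_real u * e1) =
     s * (c (z + of_real u * e1 + of_real v * e2) * Re e2 + d (z + of_real u * e1 + of_real v * e2) * Im e2)" by auto
  show ?thesis
  proof (rule that)
    show "z + of_real u * e1 + of_real v * e2 \<in> cball z (2 * s)" using u v by (intro mem) auto
    have "h (z + of_real s * e1 + of_real s * e2) - h (z + of_real s * e1) - h (z + of_real s * e2) + h z = \<phi> s - \<phi> 0"
      by (simp add: \<phi>_def add_ac)
    also have "\<dots> = s * (k (z + of_real u * e1 + of_real s * e2) - k (z + of_real u * e1))"
      by (simp add: eq add_ac)
    finally show "h (z + of_real s * e1 + of_real s * e2) - h (z + of_real s * e1) - h (z + of_real s * e2) + h z =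
       s * s * (c (z + of_real u * e1 + of_real v * e2) * Re e2 + d (z + of_real u * e1 + of_real v * e2) * Im e2)"
      by (simp add: eq2)
  qed
qed

text \<open>Schwarz's theorem, since \<open>harmonic_on\<close> supplies \<open>hxy\<close> and
  \<open>hyx\<close> as separate functions. One second difference over a small square equals both
  \<open>s * s * hxy p\<close> and \<open>s * s * hyx q\<close> with \<open>p\<close>,
  \<open>q\<close> near \<open>z\<close>; continuity then excludes a difference at
  \<open>z\<close>.\<close>

lemma mixed_partials_eq:
  fixes h hx hy :: "complex \<Rightarrow> real"
  assumes S: "open S" "z \<in> S"
    and h: "\<And>w. w \<in> S \<Longrightarrow> (h has_derivative (\<lambda>v. hx w * Re v + hy w * Im v)) (at w)"
    and hx: "\<And>w. w \<in> S \<Longrightarrow> (hx has_derivative (\<lambda>v. hxx w * Re v + hxy w * Im v)) (at w)"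
    and hy: "\<And>w. w \<in> S \<Longrightarrow> (hy has_derivative (\<lambda>v. hyx w * Re v + hyy w * Im v)) (at w)"
    and cont: "continuous_on S hxy" "continuous_on S hyx"
  shows "hxy z = hyx z"
proof (rule ccontr)
  assume "hxy z \<noteq> hyx z"
  define \<epsilon> where "\<epsilon> = \<bar>hxy z - hyx z\<bar> / 2"
  have \<epsilon>: "\<epsilon> > 0" using \<open>hxy z \<noteq> hyx z\<close> by (simp add: \<epsilon>_def)
  have "isCont hxy z" "isCont hyx z" using cont S continuous_on_eq_continuous_at by blast+
  then have "\<forall>\<^sub>F w in nhds z. dist (hxy w) (hxy z) < \<epsilon>" "\<forall>\<^sub>F w in nhds z. dist (hyx w) (hyx z) < \<epsilon>"
    using \<epsilon> by (auto simp: isCont_def tendsto_at_iff_tendsto_nhds intro: tendstoD)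
  moreover have "\<forall>\<^sub>F w in nhds z. w \<in> S" using S by (rule eventually_nhds_in_open)
  ultimately have "\<forall>\<^sub>F w in nhds z. w \<in> S \<and> dist (hxy w) (hxy z) < \<epsilon> \<and> dist (hyx w) (hyx z) < \<epsilon>"
    by eventually_elim simp
  then obtain \<delta> where \<delta>: "\<delta> > 0"
    and near: "\<And>w. dist w z < \<delta> \<Longrightarrow> w \<in> S \<and> dist (hxy w) (hxy z) < \<epsilon> \<and> dist (hyx w) (hyx z) < \<epsilon>"
    unfolding eventually_nhds_metric by blast
  define s where "s = \<delta> / 4"
  have s: "s > 0" using \<delta> by (simp add: s_def)
  have close: "w \<in> S" "dist (hxy w) (hxy z) < \<epsilon>" "dist (hyx w) (hyx z) < \<epsilon>" if "w \<in> cball z (2 * s)" for w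
    using near[of w] that \<delta> by (auto simp: s_def dist_commute)
  obtain p where p: "p \<in> cball z (2 * s)" and
    "h (z + of_real s * 1 + of_real s * \<i>) - h (z + of_real s * 1) - h (z + of_real s * \<i>) + h z =
       s * s * (hxx p * Re \<i> + hxy p * Im \<i>)"
    by (rule second_difference_mvt[of s 1 \<i> z h hx hy hx hxx hxy]) (use s h hx close(1) in auto)
  moreover obtain q where q: "q \<in> cball z (2 * s)" and
    "h (z + of_real s * \<i> + of_real s * 1) - h (z + of_real s * \<i>) - h (z + of_real s * 1) + h z =
       s * s * (hyx q * Re 1 + hyy q * Im 1)"
    by (rule second_difference_mvt[of s \<i> 1 z h hx hy hy hyx hyy]) (use s h hy close(1) in auto)
  ultimately have "s * s * hxy p = s * s * hyx q" using s by (simp add: algebra_simps)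
  then have "hxy p = hyx q" using s by simp
  then have "\<bar>hxy z - hyx z\<bar> < 2 * \<epsilon>"
    using close(2)[OF p] close(3)[OF q] by (simp add: dist_real_def)
  then show False by (simp add: \<epsilon>_def)
qed

text \<open>The derivative of \<open>F\<close> has to be \<open>g = hx - \<i> * hy\<close>, whose
  Cauchy-Riemann equations are the equality of the mixed partials and the vanishing of the
  Laplacian. Convexity of the disc gives a primitive, and its real part has the same gradient as
  \<open>h\<close>.\<close>

lemma harmonic_on_disc_imp_Re_holomorphic:
  assumes "harmonic_on h unit_disc"
  obtains F where "F holomorphic_on unit_disc" "\<And>z. z \<in> unit_disc \<Longrightarrow> h z = Re (F z)"
proof -
  obtain hx hy hxx hxy hyx hyy where
    all: "\<forall>z\<in>unit_disc. (h has_derivative (\<lambda>v. hx z * Re v + hy z * Im v)) (at z) \<and>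
      (hx has_derivative (\<lambda>v. hxx z * Re v + hxy z * Im v)) (at z) \<and>
      (hy has_derivative (\<lambda>v. hyx z * Re v + hyy z * Im v)) (at z) \<and> hxx z + hyy z = 0" and
    cont: "continuous_on unit_disc hxy" "continuous_on unit_disc hyx"
    using assms unfolding harmonic_on_def by blast
  have h: "(h has_derivative (\<lambda>v. hx z * Re v + hy z * Im v)) (at z)"
    and hx: "(hx has_derivative (\<lambda>v. hxx z * Re v + hxy z * Im v)) (at z)"
    and hy: "(hy has_derivative (\<lambda>v. hyx z * Re v + hyy z * Im v)) (at z)"
    and lap: "hxx z + hyy z = 0" if "z \<in> unit_disc" for z
    using bspec[OF all that] by blast+
  define g where "g = (\<lambda>z. of_real (hx z) - \<i> * of_real (hy z))"
  have "(g has_field_derivative (of_real (hxx z) - \<i> * of_real (hyx z))) (at z)" if z: "z \<in> unit_disc" for z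
  proof -
    have mixed: "hxy z = hyx z"
      using mixed_partials_eq[OF open_ball z h hx hy cont] by simp
    have lapz: "hyy z = - hxx z" using lap[OF z] by simp
    have "(g has_derivative (\<lambda>v. of_real (hxx z * Re v + hxy z * Im v) - \<i> * of_real (hyx z * Re v + hyy z * Im v))) (at z)"
      unfolding g_def
      by (intro has_derivative_diff has_derivative_mult_right has_derivative_of_real hx hy z)
    moreover have "(\<lambda>v. of_real (hxx z * Re v + hxy z * Im v) - \<i> * of_real (hyx z * Re v + hyy z * Im v)) =
       (*) (of_real (hxx z) - \<i> * of_real (hyx z))"
      by (auto simp: complex_eq_iff mixed lapz algebra_simps)
    ultimately show ?thesis by (simp add: has_field_derivative_def)
  qed
  then have "g holomorphic_on unit_disc"
    unfolding holomorphic_on_open[OF open_ball] by blast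
  then obtain F where F: "\<And>z. z \<in> unit_disc \<Longrightarrow> (F has_field_derivative g z) (at z within unit_disc)"
    using holomorphic_convex_primitive'[of unit_disc g] by auto
  have D: "((\<lambda>z. h z - Re (F z)) has_derivative (\<lambda>v. 0)) (at z within unit_disc)" if z: "z \<in> unit_disc" for z
  proof -
    have "((\<lambda>z. Re (F z)) has_derivative (\<lambda>v. Re (g z * v))) (at z within unit_disc)"
      using F[OF z] by (intro has_derivative_Re) (simp add: has_field_derivative_def)
    then have "((\<lambda>z. h z - Re (F z)) has_derivative (\<lambda>v. hx z * Re v + hy z * Im v - Re (g z * v))) (at z within unit_disc)"
      by (intro has_derivative_diff has_derivative_at_withinI[OF h[OF z]])
    moreover have "(\<lambda>v. hx z * Re v + hy z * Im v - Re (g z * v)) = (\<lambda>v. 0)"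
      by (auto simp: g_def)
    ultimately show ?thesis by simp
  qed
  have "\<exists>c. \<forall>z\<in>unit_disc. h z - Re (F z) = c"
    by (rule has_derivative_zero_constant[OF convex_ball D])
  then obtain c where c: "\<And>z. z \<in> unit_disc \<Longrightarrow> h z - Re (F z) = c" by blast
  have "F holomorphic_on unit_disc"
    unfolding holomorphic_on_def field_differentiable_def using F by blast
  show ?thesis
  proof
    show "(\<lambda>z. F z + of_real c) holomorphic_on unit_disc"
      by (intro holomorphic_intros) fact
    show "h z = Re (F z + of_real c)" if "z \<in> unit_disc" for z using c[OF that] by simp
  qed
qed

lemma harmonic_on_Re_holomorphic:
  assumes S: "open S" and F: "F holomorphic_on S" and h: "\<And>z. z \<in> S \<Longrightarrow> h z = Re (F z)"
  shows "harmonic_on h S"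
proof -
  define F1 where "F1 = deriv F"
  define F2 where "F2 = deriv F1"
  have F1: "F1 holomorphic_on S" unfolding F1_def by (intro holomorphic_deriv F S)
  have F2: "F2 holomorphic_on S" unfolding F2_def by (intro holomorphic_deriv F1 S)
  have dF: "(F has_derivative (*) (F1 z)) (at z)" if "z \<in> S" for z
    using holomorphic_derivI[OF F S that] by (simp add: F1_def has_field_derivative_def)
  have dF1: "(F1 has_derivative (*) (F2 z)) (at z)" if "z \<in> S" for z
    using holomorphic_derivI[OF F1 S that] by (simp add: F2_def has_field_derivative_def)
  have c: "continuous_on S F2" using F2 by (rule holomorphic_on_imp_continuous_on)
  show ?thesis
    unfolding harmonic_on_def
  \<comment> \<open>The witnesses are fixed by the derivatives shown below, according to
    \<open>F1 = hx - \<i> * hy\<close> and \<open>F2 = hxx - \<i> * hxy\<close>.\<close>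
  proof (intro conjI S exI ballI)
    fix z assume z: "z \<in> S"
    have "((\<lambda>z. Re (F z)) has_derivative (\<lambda>v. Re (F1 z * v))) (at z)"
      using dF[OF z] by (rule has_derivative_Re)
    then have "((\<lambda>z. Re (F z)) has_derivative (\<lambda>v. Re (F1 z) * Re v + - Im (F1 z) * Im v)) (at z)"
      by simp
    then show "(h has_derivative (\<lambda>v. Re (F1 z) * Re v + - Im (F1 z) * Im v)) (at z)"
      by (rule has_derivative_transform_within_open[OF _ S z]) (simp add: h)
    show "((\<lambda>z. Re (F1 z)) has_derivative (\<lambda>v. Re (F2 z) * Re v + - Im (F2 z) * Im v)) (at z)"
      using has_derivative_Re[OF dF1[OF z]] by simp
    show "((\<lambda>z. - Im (F1 z)) has_derivative (\<lambda>v. - Im (F2 z) * Re v + - Re (F2 z) * Im v)) (at z)"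
      using has_derivative_minus[OF has_derivative_Im[OF dF1[OF z]]] by (simp add: algebra_simps)
    show "Re (F2 z) + - Re (F2 z) = 0" by simp
  qed (intro continuous_intros c)+
qed

text \<open>With \<open>w = z * cnj \<eta>\<close> this is the real part of the Herglotz kernel
  \<open>(1 + w) / (1 - w)\<close>. Writing it as \<open>2 / (1 - w) - 1\<close> exposes a geometric
  series in \<open>z\<close>.\<close>

lemma poisson_kernel_eq_Re:
  assumes \<eta>: "norm \<eta> = 1" and z: "norm z < 1"
  shows "poisson_kernel z \<eta> = 2 * Re (1 / (1 - z * cnj \<eta>)) - 1"
proof -
  define w where "w = z * cnj \<eta>"
  have w: "norm w = norm z" using \<eta> by (simp add: w_def norm_mult)
  have "\<eta> * cnj \<eta> = 1" using \<eta> complex_norm_square[of \<eta>] by simp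
  then have "(\<eta> - z) * cnj \<eta> = 1 - w" by (simp add: w_def algebra_simps)
  then have n: "norm (\<eta> - z) = norm (1 - w)"
    using \<eta> by (metis complex_mod_cnj mult.right_neutral norm_mult)
  have "1 - w \<noteq> 0" using w z by auto
  then have pos: "(norm (1 - w))\<^sup>2 \<noteq> 0" by simp
  have re: "Re (1 / (1 - w)) = (1 - Re w) / (norm (1 - w))\<^sup>2"
    by (simp add: Re_divide cmod_power2)
  have "1 - (norm w)\<^sup>2 = 2 * (1 - Re w) - (norm (1 - w))\<^sup>2"
    unfolding cmod_power2 by (simp add: power2_eq_square algebra_simps)
  then have "poisson_kernel z \<eta> = (2 * (1 - Re w) - (norm (1 - w))\<^sup>2) / (norm (1 - w))\<^sup>2"
    by (simp add: poisson_kernel_def n w)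
  also have "\<dots> = 2 * Re (1 / (1 - w)) - 1"
    unfolding re using pos by (simp add: diff_divide_distrib)
  finally show ?thesis by (simp add: w_def)
qed

text \<open>On the circle \<open>norm (z * cnj \<eta>) = norm z < 1\<close>, so the geometric series
  may be summed under the integral. The coefficients are moments of \<open>\<mu>\<close>, and the
  power series is the source of holomorphy in \<open>z\<close>.\<close>

lemma cauchy_kernel_integral:
  assumes fin: "finite_measure \<mu>" and sets: "sets \<mu> = sets circle_lborel" and z: "norm z < 1"
  shows "integrable \<mu> (\<lambda>\<eta>. 1 / (1 - z * cnj \<eta>))"
    and "(\<lambda>n. (LINT \<eta>|\<mu>. cnj \<eta> ^ n) * z ^ n) sums (LINT \<eta>|\<mu>. 1 / (1 - z * cnj \<eta>))"
proof -
  interpret finite_measure \<mu> by fact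
  have space: "space \<mu> = sphere 0 1" by (rule circle_space[OF sets])
  have norm_le: "norm (z * cnj \<eta>) = norm z" if "\<eta> \<in> space \<mu>" for \<eta> using that by (simp add: space norm_mult)
  have "(\<lambda>\<eta>. cnj \<eta> ^ n) \<in> borel_measurable (borel :: complex measure)" for n
    by (intro borel_measurable_continuous_onI continuous_intros)
  then have meas: "(\<lambda>\<eta>. cnj \<eta> ^ n) \<in> borel_measurable \<mu>" for n
    by (simp add: sets sets_circle_lborel measurable_restrict_space1 cong: measurable_cong_sets)
  have int1: "integrable \<mu> (\<lambda>\<eta>. cnj \<eta> ^ n)" for n
    by (rule integrable_const_bound[of _ 1]) (auto simp: space norm_power meas)
  then have int: "integrable \<mu> (\<lambda>\<eta>. (z * cnj \<eta>) ^ n)" for n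
    by (simp add: power_mult_distrib)
  have AE: "AE \<eta> in \<mu>. summable (\<lambda>n. norm ((z * cnj \<eta>) ^ n))"
    using z by (intro AE_I2) (simp add: norm_power norm_le summable_geometric)
  have "(LINT \<eta>|\<mu>. norm ((z * cnj \<eta>) ^ n)) = norm z ^ n * measure \<mu> (space \<mu>)" for n
  proof -
    have "(LINT \<eta>|\<mu>. norm ((z * cnj \<eta>) ^ n)) = (LINT \<eta>|\<mu>. norm z ^ n)"
      by (rule Bochner_Integration.integral_cong) (simp_all add: norm_power norm_le)
    then show ?thesis by (simp add: mult.commute)
  qed
  then have summ: "summable (\<lambda>n. LINT \<eta>|\<mu>. norm ((z * cnj \<eta>) ^ n))"
    using z by (simp add: summable_mult2 summable_geometric)
  have geo: "(\<Sum>n. (z * cnj \<eta>) ^ n) = 1 / (1 - z * cnj \<eta>)" if "\<eta> \<in> space \<mu>" for \<eta>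
    using z norm_le[OF that] by (intro suminf_geometric) simp
  show "integrable \<mu> (\<lambda>\<eta>. 1 / (1 - z * cnj \<eta>))"
    using integrable_suminf[OF int AE summ] by (simp add: geo cong: Bochner_Integration.integrable_cong)
  have "(\<lambda>n. LINT \<eta>|\<mu>. (z * cnj \<eta>) ^ n) sums (LINT \<eta>|\<mu>. (\<Sum>n. (z * cnj \<eta>) ^ n))"
    by (rule sums_integral[OF int AE summ])
  also have "(LINT \<eta>|\<mu>. (\<Sum>n. (z * cnj \<eta>) ^ n)) = (LINT \<eta>|\<mu>. 1 / (1 - z * cnj \<eta>))"
    by (rule Bochner_Integration.integral_cong) (simp_all add: geo)
  finally show "(\<lambda>n. (LINT \<eta>|\<mu>. cnj \<eta> ^ n) * z ^ n) sums (LINT \<eta>|\<mu>. 1 / (1 - z * cnj \<eta>))"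
    by (simp add: power_mult_distrib mult.commute)
qed

lemma poisson_integral_eq_Re:
  assumes fin: "finite_measure \<mu>" and sets: "sets \<mu> = sets circle_lborel" and z: "norm z < 1"
  shows "integrable \<mu> (poisson_kernel z)"
    and "poisson_integral \<mu> z = Re (2 * (LINT \<eta>|\<mu>. 1 / (1 - z * cnj \<eta>)) - of_real (measure \<mu> (space \<mu>)))"
proof -
  interpret finite_measure \<mu> by fact
  have space: "space \<mu> = sphere 0 1" by (rule circle_space[OF sets])
  note int = cauchy_kernel_integral(1)[OF assms]
  have eq: "poisson_kernel z \<eta> = 2 * Re (1 / (1 - z * cnj \<eta>)) - 1" if "\<eta> \<in> space \<mu>" for \<eta>
    using that z by (intro poisson_kernel_eq_Re) (auto simp: space)
  have "integrable \<mu> (\<lambda>\<eta>. 2 * Re (1 / (1 - z * cnj \<eta>)) - 1)"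
    by (intro Bochner_Integration.integrable_diff integrable_mult_right integrable_Re int) simp
  then show "integrable \<mu> (poisson_kernel z)"
    by (subst Bochner_Integration.integrable_cong[OF refl eq])
  have "poisson_integral \<mu> z = (LINT \<eta>|\<mu>. 2 * Re (1 / (1 - z * cnj \<eta>)) - 1)"
    unfolding poisson_integral_def by (intro Bochner_Integration.integral_cong eq) auto
  also have "\<dots> = (LINT \<eta>|\<mu>. 2 * Re (1 / (1 - z * cnj \<eta>))) - (LINT \<eta>|\<mu>. 1)"
    by (intro Bochner_Integration.integral_diff integrable_mult_right integrable_Re int) simp
  also have "\<dots> = 2 * Re (LINT \<eta>|\<mu>. 1 / (1 - z * cnj \<eta>)) - measure \<mu> (space \<mu>)"
    using int by (simp only: integral_mult_right_zero integral_Re) simp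
  finally show "poisson_integral \<mu> z = Re (2 * (LINT \<eta>|\<mu>. 1 / (1 - z * cnj \<eta>)) - of_real (measure \<mu> (space \<mu>)))"
    by simp
qed

lemma nn_integral_poisson_kernel:
  assumes "finite_measure \<mu>" "sets \<mu> = sets circle_lborel" "norm z < 1"
  shows "(\<integral>\<^sup>+\<eta>. ennreal (poisson_kernel z \<eta>) \<partial>\<mu>) = ennreal (poisson_integral \<mu> z)"
  unfolding poisson_integral_def
  by (intro nn_integral_eq_integral poisson_integral_eq_Re assms AE_I2 poisson_kernel_nonneg)

lemma poisson_integral_holomorphic:
  assumes "finite_measure \<mu>" "sets \<mu> = sets circle_lborel"
  obtains F where "F holomorphic_on unit_disc" "\<And>z. z \<in> unit_disc \<Longrightarrow> poisson_integral \<mu> z = Re (F z)"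
proof
  have "(\<lambda>z. LINT \<eta>|\<mu>. 1 / (1 - z * cnj \<eta>)) holomorphic_on unit_disc"
    using cauchy_kernel_integral(2)[OF assms]
    by (intro power_series_holomorphic[of _ _ "\<lambda>n. LINT \<eta>|\<mu>. cnj \<eta> ^ n"]) simp
  then show "(\<lambda>z. 2 * (LINT \<eta>|\<mu>. 1 / (1 - z * cnj \<eta>)) - of_real (measure \<mu> (space \<mu>))) holomorphic_on unit_disc"
    by (intro holomorphic_intros)
  show "poisson_integral \<mu> z = Re (2 * (LINT \<eta>|\<mu>. 1 / (1 - z * cnj \<eta>)) - of_real (measure \<mu> (space \<mu>)))"
    if "z \<in> unit_disc" for z
    using poisson_integral_eq_Re(2)[OF assms, of z] that by simp
qed

section \<open>The majorant criteria\<close>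

lemma less_nt_max_iff: "a < nt_max \<alpha> \<phi> \<zeta> \<longleftrightarrow> (\<exists>z\<in>stolz_angle \<alpha> \<zeta>. a < ennreal (\<phi> z))"
  by (simp add: nt_max_def less_SUP_iff)

text \<open>A strict inequality passes through the supremum, so the superlevel set consists of the
  vertices whose Stolz angle meets the Borel set where \<open>\<phi>\<close> exceeds
  \<open>a\<close>.\<close>

lemma nt_max_measurable:
  assumes "nonneg_borel \<phi>"
  shows "nt_max \<alpha> \<phi> \<in> borel_measurable circle_lborel"
proof (rule borel_measurableI_greater)
  fix a :: ennreal
  have [measurable]: "\<phi> \<in> borel_measurable (restrict_space borel unit_disc)"
    using assms by (simp add: nonneg_borel_def)
  define B where "B = {z\<in>space (restrict_space borel unit_disc). a < ennreal (\<phi> z)}"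
  have "B \<in> sets (restrict_space borel unit_disc)" unfolding B_def by measurable
  then have B: "B \<in> sets borel" "B \<subseteq> unit_disc" by (auto simp: sets_restrict_space_iff)
  have "{\<zeta>\<in>space circle_lborel. a < nt_max \<alpha> \<phi> \<zeta>} = {\<zeta>\<in>sphere 0 1. \<exists>z\<in>B. z \<in> stolz_angle \<alpha> \<zeta>}"
    by (auto simp: less_nt_max_iff B_def stolz_angle_def space_restrict_space)
  then show "{\<zeta>\<in>space circle_lborel. a < nt_max \<alpha> \<phi> \<zeta>} \<in> sets circle_lborel"
    using stolz_shadow_measurable[OF B] by simp
qed

lemma nt_max_superlevel_sets:
  assumes "nonneg_borel \<phi>"
  shows "{\<zeta>\<in>sphere 0 1. a < nt_max \<alpha> \<phi> \<zeta>} \<in> sets circle_lborel"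
proof -
  have "{\<zeta>\<in>space circle_lborel. a < nt_max \<alpha> \<phi> \<zeta>} \<in> sets circle_lborel"
    using nt_max_measurable[OF assms, of \<alpha>] by measurable
  then show ?thesis by simp
qed

lemma nt_max_superlevel_stolz:
  assumes "\<zeta> \<in> {\<zeta>\<in>sphere 0 1. ennreal t < nt_max \<alpha> \<phi> \<zeta>}" "0 \<le> t"
  obtains z where "z \<in> stolz_angle \<alpha> \<zeta>" "norm z < 1" "t < \<phi> z"
  using assms by (auto simp: less_nt_max_iff stolz_angle_def ennreal_less_iff)

lemma nn_integral_poisson_density:
  assumes [measurable]: "f \<in> borel_measurable circle_lborel"
  shows "(\<integral>\<^sup>+\<eta>. ennreal (poisson_kernel z \<eta>) \<partial>density circle_lborel f) =
    (\<integral>\<^sup>+\<eta>. f \<eta> * ennreal (poisson_kernel z \<eta>) \<partial>circle_lborel)"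
proof -
  have [measurable]: "poisson_kernel z \<in> borel_measurable circle_lborel"
    by (rule poisson_kernel_circle_measurable) simp
  show ?thesis by (rule nn_integral_density) measurable
qed

lemma nn_integral_poisson_kernel_circle:
  assumes "norm z < 1"
  shows "(\<integral>\<^sup>+\<eta>. ennreal (poisson_kernel z \<eta>) \<partial>circle_lborel) = 1"
  using nn_poisson_formula[of "\<lambda>_. 1" z] assms by simp

text \<open>A harmonic function on the open disc need not be given as a Poisson integral, so the weak type
  estimate is applied to the dilates \<open>h (r z)\<close>, which converge pointwise as \<open>r\<close> tends to 1 and
  all have mean \<open>h 0\<close>.\<close>

lemma emeasure_nt_max_harmonic_majorant_le:
  assumes \<phi>: "nonneg_borel \<phi>" and maj: "harmonic_majorant \<phi> h" and t: "t > 0"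
  shows "ennreal t * emeasure circle_lborel {\<zeta>\<in>sphere 0 1. ennreal t < nt_max \<alpha> \<phi> \<zeta>}
    \<le> ennreal (400 * (1 + 2 * \<bar>\<alpha>\<bar>)\<^sup>2) * ennreal (h 0)"
proof -
  let ?E = "{\<zeta>\<in>sphere 0 1. ennreal t < nt_max \<alpha> \<phi> \<zeta>}"
  obtain F where F: "F holomorphic_on unit_disc" "\<And>z. z \<in> unit_disc \<Longrightarrow> h z = Re (F z)"
    using maj harmonic_on_disc_imp_Re_holomorphic unfolding harmonic_majorant_def by blast
  have h_ge: "\<phi> z \<le> h z" "0 \<le> h z" if "norm z < 1" for z
  proof -
    show le: "\<phi> z \<le> h z" using maj that by (simp add: harmonic_majorant_def)
    have "0 \<le> \<phi> z" using \<phi> that by (simp add: nonneg_borel_def)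
    then show "0 \<le> h z" using le by simp
  qed
  have F_cont: "continuous_on unit_disc F" by (rule holomorphic_on_imp_continuous_on[OF F(1)])
  define r where "r = (\<lambda>n. 1 - inverse (real (Suc (Suc n))))"
  have r: "0 \<le> r n" "r n < 1" for n by (auto simp: r_def field_simps)
  have r_lim: "r \<longlonglongrightarrow> 1"
    unfolding r_def using tendsto_diff[OF tendsto_const[of 1] LIMSEQ_Suc[OF LIMSEQ_inverse_real_of_nat]] by simp
  define g where "g = (\<lambda>n z. F (of_real (r n) * z))"
  have dil: "norm (of_real (r n) * z) < 1" if "norm z \<le> 1" for n and z :: complex
  proof -
    have "norm (of_real (r n) * z) \<le> r n * 1"
      unfolding norm_mult using r that by (intro mult_mono) auto
    then show ?thesis using r(2)[of n] by simp
  qed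
  have g_hol: "g n holomorphic_on cball 0 1" for n
    unfolding g_def
    by (rule holomorphic_on_compose_gen[OF _ F(1), unfolded o_def]) (auto intro!: holomorphic_intros simp: dil)
  have Re_g: "Re (g n z) = h (of_real (r n) * z)" "0 \<le> Re (g n z)" if "norm z \<le> 1" for n z
    using F(2) h_ge(2) dil[OF that] by (auto simp: g_def)
  \<comment> \<open>By \<open>nn_poisson_formula\<close> each dilate is the Poisson integral of its
    own boundary values. The kernel at the origin is 1, so \<open>\<mu> n\<close> has mass
    \<open>h 0\<close>.\<close>
  define \<mu> where "\<mu> = (\<lambda>n. density circle_lborel (\<lambda>\<eta>. ennreal (Re (g n \<eta>))))"
  have sets_\<mu>: "sets (\<mu> n) = sets circle_lborel" for n by (simp add: \<mu>_def)
  have meas: "(\<lambda>\<eta>. ennreal (Re (g n \<eta>))) \<in> borel_measurable circle_lborel" for n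
  proof -
    have "continuous_on (sphere 0 1) (\<lambda>\<eta>. Re (g n \<eta>))"
      by (intro continuous_intros continuous_on_subset[OF holomorphic_on_imp_continuous_on[OF g_hol]]) auto
    then have [measurable]: "(\<lambda>\<eta>. Re (g n \<eta>)) \<in> borel_measurable circle_lborel"
      by (simp add: borel_measurable_continuous_on_restrict sets_circle_lborel cong: measurable_cong_sets)
    show ?thesis by measurable
  qed
  have pois: "(\<integral>\<^sup>+\<eta>. ennreal (poisson_kernel z \<eta>) \<partial>\<mu> n) = ennreal (Re (g n z))" if "norm z < 1" for n z
    unfolding \<mu>_def nn_integral_poisson_density[OF meas]
    using nn_poisson_formula[OF g_hol that Re_g(2)] by (simp add: mult.commute)
  have mass: "emeasure (\<mu> n) (sphere 0 1) = ennreal (h 0)" for n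
  proof -
    have "emeasure (\<mu> n) (space (\<mu> n)) = (\<integral>\<^sup>+\<eta>. 1 \<partial>\<mu> n)" by simp
    also have "\<dots> = (\<integral>\<^sup>+\<eta>. ennreal (poisson_kernel 0 \<eta>) \<partial>\<mu> n)"
      by (intro nn_integral_cong) (simp add: \<mu>_def poisson_kernel_def)
    also have "\<dots> = ennreal (h 0)" using pois[of 0 n] Re_g(1)[of 0 n] by simp
    finally show ?thesis by (simp add: \<mu>_def)
  qed
  define E where "E = (\<lambda>n. {\<zeta>\<in>sphere 0 1. \<exists>z\<in>{z\<in>unit_disc. t < Re (g n z)}. z \<in> stolz_angle \<alpha> \<zeta>})"
  have E_meas: "E n \<in> sets circle_lborel" for n
  proof -
    have "continuous_on unit_disc (\<lambda>z. Re (g n z))"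
      by (intro continuous_intros continuous_on_subset[OF holomorphic_on_imp_continuous_on[OF g_hol]]) auto
    then have "open (unit_disc \<inter> (\<lambda>z. Re (g n z)) -` {t<..})"
      by (rule continuous_open_preimage) auto
    moreover have "unit_disc \<inter> (\<lambda>z. Re (g n z)) -` {t<..} = {z\<in>unit_disc. t < Re (g n z)}" by auto
    ultimately show ?thesis unfolding E_def by (intro stolz_shadow_measurable) auto
  qed
  have E_le: "ennreal t * emeasure circle_lborel (E n) \<le> ennreal (400 * (1 + 2 * \<bar>\<alpha>\<bar>)\<^sup>2) * ennreal (h 0)" for n
    unfolding mass[symmetric, of n]
  proof (rule emeasure_nt_poisson_le[OF sets_\<mu> t E_meas])
    fix \<zeta> assume "\<zeta> \<in> E n"
    then obtain z where "z \<in> stolz_angle \<alpha> \<zeta>" "norm z < 1" "t < Re (g n z)" by (auto simp: E_def)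
    then show "\<exists>z\<in>stolz_angle \<alpha> \<zeta>. ennreal t < (\<integral>\<^sup>+\<eta>. ennreal (poisson_kernel z \<eta>) \<partial>\<mu> n)"
      using t by (intro bexI[of _ z]) (simp_all add: pois ennreal_less_iff)
  qed
  \<comment> \<open>The dilates need not be monotone in \<open>n\<close>, so tails are intersected.
    A point \<open>z\<close> with \<open>t < h z\<close> satisfies the strict inequality for all
    late dilates, hence its vertices lie in some \<open>G n\<close>; \<open>G\<close> increases, and
    continuity from below transfers the bound for the \<open>E n\<close>.\<close>
  define G where "G = (\<lambda>n. \<Inter>m\<in>{n..}. E m)"
  have G_meas: "G n \<in> sets circle_lborel" for n
  proof -
    have "E ` {n..} \<subseteq> sets circle_lborel" using E_meas by blast
    then show ?thesis unfolding G_def by (intro sets.countable_INT') auto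
  qed
  have G_inc: "incseq G" by (auto simp: G_def incseq_def)
  have "?E \<subseteq> (\<Union>n. G n)"
  proof
    fix \<zeta> assume \<zeta>: "\<zeta> \<in> ?E"
    then obtain z where z: "z \<in> stolz_angle \<alpha> \<zeta>" "norm z < 1" "t < \<phi> z"
      using t by (elim nt_max_superlevel_stolz) auto
    have "isCont F z" using F_cont z by (simp add: continuous_on_eq_continuous_at)
    moreover have "(\<lambda>n. of_real (r n) * z) \<longlonglongrightarrow> of_real 1 * z" by (intro tendsto_intros r_lim)
    ultimately have "(\<lambda>n. g n z) \<longlonglongrightarrow> F z" unfolding g_def by (intro isCont_tendsto_compose[of z F]) auto
    then have "(\<lambda>n. Re (g n z)) \<longlonglongrightarrow> Re (F z)" by (rule tendsto_Re)
    moreover have "t < Re (F z)" using z F(2)[of z] h_ge(1)[of z] by simp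
    ultimately have "\<forall>\<^sub>F n in sequentially. t < Re (g n z)" by (rule order_tendstoD)
    then obtain N where "\<And>n. n \<ge> N \<Longrightarrow> t < Re (g n z)" by (auto simp: eventually_sequentially)
    then have "\<zeta> \<in> G N" using z \<zeta> by (auto simp: G_def E_def)
    then show "\<zeta> \<in> (\<Union>n. G n)" by blast
  qed
  then have "ennreal t * emeasure circle_lborel ?E \<le> ennreal t * emeasure circle_lborel (\<Union>n. G n)"
  proof (intro mult_left_mono emeasure_mono)
    show "(\<Union>n. G n) \<in> sets circle_lborel" using G_meas by blast
  qed auto
  also have "\<dots> = (SUP n. ennreal t * emeasure circle_lborel (G n))"
    using G_meas G_inc by (subst SUP_emeasure_incseq[symmetric]) (auto simp: SUP_mult_left_ennreal)
  also have "\<dots> \<le> ennreal (400 * (1 + 2 * \<bar>\<alpha>\<bar>)\<^sup>2) * ennreal (h 0)"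
  proof (rule SUP_least)
    fix n
    have "ennreal t * emeasure circle_lborel (G n) \<le> ennreal t * emeasure circle_lborel (E n)"
      using E_meas by (intro mult_left_mono emeasure_mono) (auto simp: G_def)
    then show "ennreal t * emeasure circle_lborel (G n) \<le> ennreal (400 * (1 + 2 * \<bar>\<alpha>\<bar>)\<^sup>2) * ennreal (h 0)"
      using E_le[of n] by simp
  qed
  finally show ?thesis .
qed

lemma nt_max_weak_L1:
  assumes \<phi>: "nonneg_borel \<phi>" and maj: "harmonic_majorant \<phi> h"
  shows "nt_max \<alpha> \<phi> \<in> weak_L1"
proof -
  let ?E = "\<lambda>t. {\<zeta>\<in>sphere 0 1. ennreal t < nt_max \<alpha> \<phi> \<zeta>}"
  have "(SUP t\<in>{0::real<..}. ennreal t * emeasure circle_lebesgue (?E t))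
     \<le> ennreal (400 * (1 + 2 * \<bar>\<alpha>\<bar>)\<^sup>2) * ennreal (h 0)"
    unfolding circle_lebesgue_def
    using emeasure_nt_max_harmonic_majorant_le[OF \<phi> maj] nt_max_superlevel_sets[OF \<phi>]
    by (intro SUP_least) simp
  also have "\<dots> < \<infinity>" by (simp add: ennreal_mult_less_top)
  finally show ?thesis
    using nt_max_measurable[OF \<phi>]
    by (simp add: weak_L1_def circle_lebesgue_def measurable_completion)
qed

text \<open>Bounded boundary density contributes at most \<open>N\<close> to the Poisson integral, so only the small
  measure carried by \<open>{f > N}\<close> enters the weak type estimate at heights above \<open>2 N\<close>.\<close>

lemma nt_max_weak_L1_0:
  assumes \<phi>: "nonneg_borel \<phi>" and \<mu>: "ac_boundary_measure \<mu>"
    and maj: "\<And>z. z \<in> unit_disc \<Longrightarrow> \<phi> z \<le> poisson_integral \<mu> z"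
  shows "nt_max \<alpha> \<phi> \<in> weak_L1_0"
proof -
  let ?E = "\<lambda>t. {\<zeta>\<in>sphere 0 1. ennreal t < nt_max \<alpha> \<phi> \<zeta>}"
  have fin: "finite_measure \<mu>" and sets: "sets \<mu> = sets circle_lborel" and ac: "absolutely_continuous circle_lborel \<mu>"
    using \<mu> by (auto simp: ac_boundary_measure_def)
  interpret \<sigma>: finite_measure circle_lborel by (rule finite_measure_circle_lborel)
  interpret \<mu>: finite_measure \<mu> by (rule fin)
  obtain f where f [measurable]: "f \<in> borel_measurable circle_lborel" and dens: "density circle_lborel f = \<mu>"
    using \<sigma>.Radon_Nikodym[OF ac sets] by blast
  have [measurable]: "poisson_kernel z \<in> borel_measurable circle_lborel" for z
    by (rule poisson_kernel_circle_measurable) simp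
  define A where "A = (\<lambda>N::nat. {\<eta>\<in>space circle_lborel. of_nat N < f \<eta>})"
  have A [measurable]: "A N \<in> sets circle_lborel" for N unfolding A_def by measurable
  \<comment> \<open>The limit is the mass of the set where \<open>f\<close> is infinite. This set is
    null because \<open>\<mu>\<close> is finite, that is, \<open>f\<close> has finite
    integral.\<close>
  have "(\<lambda>N. emeasure \<mu> (A N)) \<longlonglongrightarrow> emeasure \<mu> (\<Inter>N. A N)"
  proof (rule Lim_emeasure_decseq)
    show "decseq A"
      unfolding decseq_def A_def by (auto intro: le_less_trans[rotated] simp: of_nat_mono)
    show "range A \<subseteq> sets \<mu>" unfolding sets using A by blast
  qed (simp add: \<mu>.emeasure_eq_measure)
  also have "(\<Inter>N. A N) = {\<eta>\<in>space circle_lborel. f \<eta> = \<infinity>}"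
  proof (intro equalityI subsetI)
    fix \<eta> assume "\<eta> \<in> (\<Inter>N. A N)"
    then have "\<eta> \<in> space circle_lborel" "\<And>N. of_nat N < f \<eta>" by (auto simp: A_def)
    moreover have "f \<eta> = \<infinity>"
    proof (rule ccontr)
      assume "f \<eta> \<noteq> \<infinity>"
      then obtain n where "f \<eta> < of_nat n" using ennreal_Ex_less_of_nat[of "f \<eta>"] by (auto simp: less_top)
      then show False using \<open>\<And>N. of_nat N < f \<eta>\<close>[of n] by (simp add: less_imp_not_less)
    qed
    ultimately show "\<eta> \<in> {\<eta>\<in>space circle_lborel. f \<eta> = \<infinity>}" by simp
  next
    fix \<eta> assume "\<eta> \<in> {\<eta>\<in>space circle_lborel. f \<eta> = \<infinity>}"
    then show "\<eta> \<in> (\<Inter>N. A N)" by (auto simp: A_def of_nat_less_top)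
  qed
  also have "emeasure \<mu> \<dots> = 0"
  proof (rule absolutely_continuousD[OF ac])
    have "(\<integral>\<^sup>+\<eta>. f \<eta> \<partial>circle_lborel) = (\<integral>\<^sup>+\<eta>. f \<eta> * indicator (space circle_lborel) \<eta> \<partial>circle_lborel)"
      by (intro nn_integral_cong) auto
    also have "\<dots> = emeasure \<mu> (space circle_lborel)"
      by (subst dens[symmetric], subst emeasure_density) auto
    also have "\<dots> \<noteq> \<infinity>" by (simp add: \<mu>.emeasure_eq_measure)
    finally have "emeasure circle_lborel (f -` {\<infinity>} \<inter> space circle_lborel) = 0"
      by (intro nn_integral_PInf) auto
    moreover have "f -` {\<infinity>} \<inter> space circle_lborel = {\<eta>\<in>space circle_lborel. f \<eta> = \<infinity>}" by auto
    ultimately show "emeasure circle_lborel {\<eta>\<in>space circle_lborel. f \<eta> = \<infinity>} = 0" by simp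
  qed measurable
  finally have A_lim: "(\<lambda>N. emeasure \<mu> (A N)) \<longlonglongrightarrow> 0" .
  define C where "C = 400 * (1 + 2 * \<bar>\<alpha>\<bar>)\<^sup>2"
  have C: "C > 0" by (auto simp: C_def intro!: mult_pos_pos zero_less_power add_pos_nonneg)
  \<comment> \<open>The density off \<open>A N\<close> is at most \<open>N\<close>, and so is its
    Poisson integral, with \<open>N \<le> t/2\<close>. The part on \<open>A N\<close> must then
    exceed \<open>t/2\<close>; this halving is the origin of the factor 2.\<close>
  have key: "t * measure circle_lborel (?E t) \<le> 2 * C * measure \<mu> (A N)" if t: "t \<ge> 2 * real N" "t > 0" for t N
  proof -
    let ?\<nu> = "density circle_lborel (\<lambda>\<eta>. f \<eta> * indicator (A N) \<eta>)"
    have "ennreal (t/2) * emeasure circle_lborel (?E t) \<le> ennreal (400 * (1 + 2 * \<bar>\<alpha>\<bar>)\<^sup>2) * emeasure ?\<nu> (sphere 0 1)"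
    proof (rule emeasure_nt_poisson_le)
      show "?E t \<in> sets circle_lborel" by (rule nt_max_superlevel_sets[OF \<phi>])
      fix \<zeta> assume "\<zeta> \<in> ?E t"
      then obtain z where z: "z \<in> stolz_angle \<alpha> \<zeta>" "norm z < 1" "t < \<phi> z"
        using t by (elim nt_max_superlevel_stolz) auto
      let ?P = "\<lambda>\<eta>. ennreal (poisson_kernel z \<eta>)"
      have "ennreal t < ennreal (poisson_integral \<mu> z)"
        using z maj[of z] t by (intro ennreal_lessI) auto
      also have "\<dots> = (\<integral>\<^sup>+\<eta>. ?P \<eta> \<partial>\<mu>)" using nn_integral_poisson_kernel[OF fin sets z(2)] by simp
      also have "\<dots> = (\<integral>\<^sup>+\<eta>. f \<eta> * ?P \<eta> \<partial>circle_lborel)"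
        by (subst dens[symmetric], rule nn_integral_poisson_density) measurable
      also have "\<dots> \<le> (\<integral>\<^sup>+\<eta>. (f \<eta> * indicator (A N) \<eta>) * ?P \<eta> + of_nat N * ?P \<eta> \<partial>circle_lborel)"
      proof (rule nn_integral_mono)
        fix \<eta> assume \<eta>: "\<eta> \<in> space circle_lborel"
        show "f \<eta> * ?P \<eta> \<le> (f \<eta> * indicator (A N) \<eta>) * ?P \<eta> + of_nat N * ?P \<eta>"
        proof (cases "\<eta> \<in> A N")
          case False
          then have "f \<eta> \<le> of_nat N" using \<eta> by (auto simp: A_def not_less)
          then show ?thesis using False by (simp add: mult_right_mono)
        qed simp
      qed
      also have "\<dots> = (\<integral>\<^sup>+\<eta>. (f \<eta> * indicator (A N) \<eta>) * ?P \<eta> \<partial>circle_lborel) + of_nat N * (\<integral>\<^sup>+\<eta>. ?P \<eta> \<partial>circle_lborel)"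
        by (subst nn_integral_add) (simp_all add: nn_integral_cmult)
      also have "\<dots> = (\<integral>\<^sup>+\<eta>. ?P \<eta> \<partial>?\<nu>) + ennreal (real N)"
        by (subst nn_integral_poisson_density)
           (simp_all add: nn_integral_poisson_kernel_circle[OF z(2)] ennreal_of_nat_eq_real_of_nat)
      finally have less: "ennreal t < (\<integral>\<^sup>+\<eta>. ?P \<eta> \<partial>?\<nu>) + ennreal (real N)" .
      have "ennreal (t/2) < (\<integral>\<^sup>+\<eta>. ?P \<eta> \<partial>?\<nu>)"
      proof (rule ccontr)
        assume "\<not> ?thesis"
        then have "(\<integral>\<^sup>+\<eta>. ?P \<eta> \<partial>?\<nu>) + ennreal (real N) \<le> ennreal (t/2) + ennreal (real N)"
          by (intro add_right_mono) (simp add: not_less)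
        also have "\<dots> = ennreal (t/2 + real N)" using t by (simp add: ennreal_plus)
        also have "\<dots> \<le> ennreal t" using t by (intro ennreal_leI) simp
        finally show False using less by (simp add: not_less[symmetric])
      qed
      then show "\<exists>z\<in>stolz_angle \<alpha> \<zeta>. ennreal (t/2) < (\<integral>\<^sup>+\<eta>. ennreal (poisson_kernel z \<eta>) \<partial>?\<nu>)"
        using z by blast
    qed (use t in auto)
    also have "emeasure ?\<nu> (sphere 0 1) = emeasure \<mu> (A N)"
    proof -
      have "emeasure ?\<nu> (space circle_lborel) = (\<integral>\<^sup>+\<eta>. f \<eta> * indicator (A N) \<eta> \<partial>circle_lborel)"
        by (subst emeasure_density) (auto intro!: nn_integral_cong)
      also have "\<dots> = emeasure \<mu> (A N)" by (subst dens[symmetric], subst emeasure_density) auto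
      finally show ?thesis by simp
    qed
    also have "ennreal (400 * (1 + 2 * \<bar>\<alpha>\<bar>)\<^sup>2) * emeasure \<mu> (A N) = ennreal (C * measure \<mu> (A N))"
      using C by (simp add: C_def \<mu>.emeasure_eq_measure ennreal_mult)
    also have "ennreal (t/2) * emeasure circle_lborel (?E t) = ennreal (t/2 * measure circle_lborel (?E t))"
      using t by (simp only: \<sigma>.emeasure_eq_measure) (intro ennreal_mult[symmetric]; simp)
    finally have "t/2 * measure circle_lborel (?E t) \<le> C * measure \<mu> (A N)"
      using C by (simp add: ennreal_le_iff)
    then show ?thesis by simp
  qed
  have "((\<lambda>t. t * measure circle_lborel (?E t)) \<longlongrightarrow> 0) at_top"
  proof (rule tendstoI)
    fix \<epsilon> :: real assume \<epsilon>: "\<epsilon> > 0"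
    have "(\<lambda>N. measure \<mu> (A N)) \<longlonglongrightarrow> 0"
      using A_lim tendsto_enn2real[of "\<lambda>N. emeasure \<mu> (A N)" 0 sequentially] by (simp add: measure_def)
    then have "\<forall>\<^sub>F N in sequentially. measure \<mu> (A N) < \<epsilon> / (2 * C)"
      using \<epsilon> C by (intro order_tendstoD(2)) auto
    then obtain N where N: "measure \<mu> (A N) < \<epsilon> / (2 * C)"
      by (auto simp: eventually_sequentially)
    show "\<forall>\<^sub>F t in at_top. dist (t * measure circle_lborel (?E t)) 0 < \<epsilon>"
      using eventually_ge_at_top[of "2 * real N"] eventually_gt_at_top[of 0]
    proof eventually_elim
      case (elim t)
      have "t * measure circle_lborel (?E t) \<le> 2 * C * measure \<mu> (A N)" using elim by (intro key)
      also have "\<dots> < \<epsilon>" using N C by (simp add: field_simps)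
      finally show ?case using elim by (simp add: abs_mult)
    qed
  qed
  then show ?thesis
    using nt_max_measurable[OF \<phi>] nt_max_superlevel_sets[OF \<phi>]
    by (simp add: weak_L1_0_def circle_lebesgue_def measurable_completion)
qed

section \<open>Majorization by the Poisson integral of the maximal function\<close>

lemma poisson_integral_density_circle_lebesgue:
  assumes [measurable]: "f \<in> borel_measurable circle_lborel"
  shows "poisson_integral (density circle_lebesgue f) = poisson_integral (density circle_lborel f)"
proof
  fix z
  have "f \<in> borel_measurable (completion circle_lborel)"
    by (rule measurable_completion) measurable
  \<comment> \<open>Kernel and density are Borel, so completing the measure changes no integral.
    This reconciles \<open>circle_lebesgue\<close> with \<open>ac_boundary_measure\<close>, which
    asks for the Borel sets of the circle.\<close>
  then have "integral\<^sup>L (density circle_lborel f) (poisson_kernel z) = integral\<^sup>L (density circle_lebesgue f) (poisson_kernel z)"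
    unfolding circle_lebesgue_def
    by (intro integral_subalgebra)
       (auto simp: emeasure_density nn_integral_completion poisson_kernel_circle_measurable)
  then show "poisson_integral (density circle_lebesgue f) z = poisson_integral (density circle_lborel f) z"
    by (simp add: poisson_integral_def)
qed

text \<open>The squared distance is \<open>(1 - r)^2 + 2 * r * (1 - cos (t - \<beta>))\<close>, and
  \<open>1 - cos u \<le> u^2 / 2\<close> bounds it by \<open>(1 - r)^2 * (1 + r)\<close>, hence by
  \<open>(1 - r^2)^2\<close>. So aperture 1 already suffices for this arc.\<close>

lemma stolz_shadow_contains_arc:
  assumes \<alpha>: "1 \<le> \<alpha>" and r: "0 \<le> r" "r < 1" and t: "\<bar>t - \<beta>\<bar> \<le> 1 - r"
  shows "of_real r * cis \<beta> \<in> stolz_angle \<alpha> (cis t)"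
proof -
  let ?u = "t - \<beta>"
  have "2 * (?u / 2) = ?u" by simp
  then have "cos ?u = 1 - 2 * (sin (?u / 2))\<^sup>2" using cos_double_sin[of "?u / 2"] by (simp only:)
  moreover have "(sin (?u / 2))\<^sup>2 \<le> (?u / 2)\<^sup>2"
    unfolding abs_le_square_iff[symmetric] by (rule abs_sin_x_le_abs_x)
  ultimately have cos: "1 - cos ?u \<le> ?u\<^sup>2 / 2" by (simp add: power_divide)
  have "?u\<^sup>2 \<le> (1 - r)\<^sup>2" using t r by (simp add: abs_le_square_iff[symmetric])
  have nr: "norm (of_real r * cis \<beta>) = r" using r by (simp add: norm_mult)
  have "(norm (cis t - of_real r * cis \<beta>))\<^sup>2 = (1 - r)\<^sup>2 + 2 * r * (1 - cos ?u)"
    unfolding norm_cis_diff_sq by (simp add: power2_eq_square algebra_simps)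
  also have "\<dots> \<le> (1 - r)\<^sup>2 + 2 * r * ((1 - r)\<^sup>2 / 2)"
    using cos \<open>?u\<^sup>2 \<le> (1 - r)\<^sup>2\<close> r by (intro add_left_mono mult_left_mono) auto
  also have "\<dots> = (1 - r)\<^sup>2 * (1 + r)" by (simp add: algebra_simps)
  also have "\<dots> \<le> (1 - r)\<^sup>2 * (1 + r)\<^sup>2"
    using r by (intro mult_left_mono) (auto simp: power2_eq_square)
  also have "\<dots> = (1 - r\<^sup>2)\<^sup>2" by (simp add: power2_eq_square algebra_simps)
  finally have "norm (cis t - of_real r * cis \<beta>) \<le> 1 - r\<^sup>2"
    by (rule power2_le_imp_le) (use r in \<open>simp add: abs_square_le_1\<close>)
  also have "\<dots> \<le> \<alpha> * (1 - r\<^sup>2)"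
    using \<alpha> r mult_right_mono[of 1 \<alpha> "1 - r\<^sup>2"] by (simp add: abs_square_le_1)
  finally show ?thesis
    using r by (simp add: stolz_angle_def nr norm_minus_commute)
qed

lemma emeasure_stolz_shadow_ge:
  assumes \<alpha>: "1 \<le> \<alpha>" and z: "norm z < 1"
  shows "ennreal ((1 - norm z) / (2 * pi)) \<le> emeasure circle_lborel {\<zeta>\<in>sphere 0 1. z \<in> stolz_angle \<alpha> \<zeta>}"
proof -
  define r where "r = norm z"
  define \<beta> where "\<beta> = Arg2pi z"
  have r: "0 \<le> r" "r < 1" using z by (auto simp: r_def)
  have \<beta>: "0 \<le> \<beta>" "\<beta> \<le> 2 * pi" using Arg2pi_ge_0[of z] Arg2pi_lt_2pi[of z] by (auto simp: \<beta>_def)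
  have z_eq: "z = of_real r * cis \<beta>" using Arg2pi_eq[of z] by (simp add: \<beta>_def r_def cis_conv_exp)
  \<comment> \<open>Half of the arc is used, on the side of \<open>\<beta>\<close> where it stays
    inside \<open>{0..2 * pi}\<close>, so that it does not wrap around the cut.\<close>
  define a where "a = (if \<beta> + (1 - r) \<le> 2 * pi then \<beta> else \<beta> - (1 - r))"
  have a: "{a..a + (1 - r)} \<subseteq> {0..2 * pi}" "{a..a + (1 - r)} \<subseteq> {t. \<bar>t - \<beta>\<bar> \<le> 1 - r}"
    using \<beta> r pi_ge_two by (auto simp: a_def)
  have "{\<zeta>\<in>sphere 0 1. \<exists>w\<in>{z}. w \<in> stolz_angle \<alpha> \<zeta>} \<in> sets circle_lborel"
    using z by (intro stolz_shadow_measurable) auto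
  then have I: "{\<zeta>\<in>sphere 0 1. z \<in> stolz_angle \<alpha> \<zeta>} \<in> sets circle_lborel" by simp
  have "{a..a + (1 - r)} \<subseteq> {t\<in>{0..2 * pi}. cis t \<in> {\<zeta>\<in>sphere 0 1. z \<in> stolz_angle \<alpha> \<zeta>}}"
    using a stolz_shadow_contains_arc[OF \<alpha> r] by (auto simp: z_eq)
  then have "emeasure lborel {a..a + (1 - r)} \<le>
      emeasure lborel {t\<in>{0..2 * pi}. cis t \<in> {\<zeta>\<in>sphere 0 1. z \<in> stolz_angle \<alpha> \<zeta>}}"
    by (rule emeasure_mono) (rule cis_preimage_sets[OF I])
  then have "ennreal (1 - r) / ennreal (2 * pi) \<le> emeasure circle_lborel {\<zeta>\<in>sphere 0 1. z \<in> stolz_angle \<alpha> \<zeta>}"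
    unfolding emeasure_circle_lborel[OF I] using r by (intro divide_right_mono_ennreal) simp
  then show ?thesis using r by (simp add: divide_ennreal r_def)
qed

text \<open>The Stolz condition bounds the denominator of the kernel by
  \<open>\<alpha>^2 * (1 - (norm z)^2)^2\<close>; one factor cancels against the numerator, and
  \<open>1 + norm z \<le> 2\<close> gives the 2.\<close>

lemma poisson_kernel_stolz_ge:
  assumes \<alpha>: "\<alpha> > 0" and z: "z \<in> stolz_angle \<alpha> \<zeta>" and \<zeta>: "norm \<zeta> = 1"
  shows "1 / (2 * \<alpha>\<^sup>2 * (1 - norm z)) \<le> poisson_kernel z \<zeta>"
proof -
  have nz: "norm z < 1" and dist: "norm (\<zeta> - z) \<le> \<alpha> * (1 - (norm z)\<^sup>2)"
    using z by (auto simp: stolz_angle_def norm_minus_commute)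
  have sq: "1 - (norm z)\<^sup>2 = (1 - norm z) * (1 + norm z)" by (simp add: power2_eq_square algebra_simps)
  have q: "0 < 1 - (norm z)\<^sup>2" using nz by (simp add: abs_square_less_1)
  have "\<zeta> \<noteq> z" using \<zeta> nz by auto
  then have pos: "0 < (norm (\<zeta> - z))\<^sup>2" by simp
  have "1 / (2 * \<alpha>\<^sup>2 * (1 - norm z)) \<le> 1 / (\<alpha>\<^sup>2 * (1 - (norm z)\<^sup>2))"
  proof (rule divide_left_mono)
    have "\<alpha>\<^sup>2 * (1 - (norm z)\<^sup>2) \<le> \<alpha>\<^sup>2 * ((1 - norm z) * 2)"
      unfolding sq using nz by (intro mult_left_mono) auto
    also have "\<dots> = 2 * \<alpha>\<^sup>2 * (1 - norm z)" by (simp only: mult_ac)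
    finally show "\<alpha>\<^sup>2 * (1 - (norm z)\<^sup>2) \<le> 2 * \<alpha>\<^sup>2 * (1 - norm z)" .
  qed (use \<alpha> q nz in auto)
  also have "\<dots> = (1 - (norm z)\<^sup>2) / (\<alpha> * (1 - (norm z)\<^sup>2))\<^sup>2"
    using q \<alpha> by (simp add: power2_eq_square)
  also have "\<dots> \<le> (1 - (norm z)\<^sup>2) / (norm (\<zeta> - z))\<^sup>2"
  proof (rule divide_left_mono)
    show "(norm (\<zeta> - z))\<^sup>2 \<le> (\<alpha> * (1 - (norm z)\<^sup>2))\<^sup>2" using dist by (intro power_mono) auto
  qed (use q \<alpha> pos in auto)
  finally show ?thesis by (simp add: poisson_kernel_def)
qed

text \<open>The lower bounds for the kernel and for the measure of the arc multiply to
  \<open>1 / (4 * pi * \<alpha>^2)\<close>, the factors \<open>1 - norm z\<close> cancelling.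
  Finiteness allows the passage from the integral in \<open>ennreal\<close> to the Bochner integral
  in \<open>poisson_integral\<close>.\<close>

lemma le_poisson_integral_nt_max:
  assumes \<alpha>: "1 \<le> \<alpha>" and \<phi>: "nonneg_borel \<phi>" and z: "norm z < 1"
    and fin: "finite_measure (density circle_lborel (nt_max \<alpha> \<phi>))"
  shows "\<phi> z \<le> 4 * pi * \<alpha>\<^sup>2 * poisson_integral (density circle_lborel (nt_max \<alpha> \<phi>)) z"
proof -
  let ?f = "nt_max \<alpha> \<phi>" and ?\<mu> = "density circle_lborel (nt_max \<alpha> \<phi>)"
  let ?I = "{\<zeta>\<in>sphere 0 1. z \<in> stolz_angle \<alpha> \<zeta>}"
  define q where "q = 1 / (2 * \<alpha>\<^sup>2 * (1 - norm z))"
  have q: "q \<ge> 0" using z by (simp add: q_def)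
  have \<phi>z: "0 \<le> \<phi> z" using \<phi> z by (simp add: nonneg_borel_def)
  note f = nt_max_measurable[OF \<phi>, of \<alpha>]
  have "{\<zeta>\<in>sphere 0 1. \<exists>w\<in>{z}. w \<in> stolz_angle \<alpha> \<zeta>} \<in> sets circle_lborel"
    using z by (intro stolz_shadow_measurable) auto
  then have I: "?I \<in> sets circle_lborel" by simp
  have "q * (1 - norm z) = 1 / (2 * \<alpha>\<^sup>2)" using z by (simp add: q_def)
  moreover have "\<phi> z * q * ((1 - norm z) / (2 * pi)) = \<phi> z * (q * (1 - norm z)) / (2 * pi)" by simp
  ultimately have "ennreal (\<phi> z / (4 * pi * \<alpha>\<^sup>2)) = ennreal (\<phi> z * q * ((1 - norm z) / (2 * pi)))"
    by (simp add: mult_ac)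
  also have "\<dots> = ennreal (\<phi> z * q) * ennreal ((1 - norm z) / (2 * pi))"
    using \<phi>z q z by (intro ennreal_mult) auto
  also have "\<dots> \<le> ennreal (\<phi> z * q) * emeasure circle_lborel ?I"
    by (intro mult_left_mono emeasure_stolz_shadow_ge \<alpha> z) auto
  also have "\<dots> = (\<integral>\<^sup>+\<eta>. ennreal (\<phi> z * q) * indicator ?I \<eta> \<partial>circle_lborel)"
    using I by (simp add: nn_integral_cmult_indicator)
  also have "\<dots> \<le> (\<integral>\<^sup>+\<eta>. ?f \<eta> * ennreal (poisson_kernel z \<eta>) \<partial>circle_lborel)"
  proof (rule nn_integral_mono)
    fix \<eta>
    show "ennreal (\<phi> z * q) * indicator ?I \<eta> \<le> ?f \<eta> * ennreal (poisson_kernel z \<eta>)"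
    proof (cases "\<eta> \<in> ?I")
      case True
      then have "ennreal (\<phi> z) \<le> ?f \<eta>" unfolding nt_max_def by (intro SUP_upper) auto
      moreover have "ennreal q \<le> ennreal (poisson_kernel z \<eta>)"
        unfolding q_def using True \<alpha> by (intro ennreal_leI poisson_kernel_stolz_ge) auto
      ultimately have "ennreal (\<phi> z) * ennreal q \<le> ?f \<eta> * ennreal (poisson_kernel z \<eta>)"
        by (rule mult_mono) auto
      then show ?thesis using True \<phi>z q by (simp add: ennreal_mult)
    qed simp
  qed
  also have "\<dots> = ennreal (poisson_integral ?\<mu> z)"
    unfolding nn_integral_poisson_density[OF f, symmetric]
    by (rule nn_integral_poisson_kernel[OF fin _ z]) simp
  finally have "\<phi> z / (4 * pi * \<alpha>\<^sup>2) \<le> poisson_integral ?\<mu> z"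
  proof (subst (asm) ennreal_le_iff)
    show "0 \<le> poisson_integral ?\<mu> z"
      unfolding poisson_integral_def by (intro integral_nonneg_AE AE_I2 poisson_kernel_nonneg z)
  qed
  then show ?thesis using \<alpha> by (simp add: divide_le_eq mult_ac)
qed

lemma quasi_bounded_poisson_integral:
  assumes "ac_boundary_measure \<mu>"
  shows "quasi_bounded (poisson_integral \<mu>)"
proof -
  have fin: "finite_measure \<mu>" and sets: "sets \<mu> = sets circle_lborel"
    using assms by (auto simp: ac_boundary_measure_def)
  obtain F where F: "F holomorphic_on unit_disc" "\<And>z. z \<in> unit_disc \<Longrightarrow> poisson_integral \<mu> z = Re (F z)"
    using poisson_integral_holomorphic[OF fin sets] by blast
  have "harmonic_on (poisson_integral \<mu>) unit_disc"
    using F by (intro harmonic_on_Re_holomorphic) auto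
  \<comment> \<open>A positive measure has nothing to subtract, so the zero measure serves as
    \<open>\<nu>\<close>.\<close>
  moreover have "ac_boundary_measure (null_measure circle_lborel)"
    by (auto simp: ac_boundary_measure_def absolutely_continuous_def null_sets_def intro!: finite_measureI)
  ultimately show ?thesis
    unfolding quasi_bounded_def using assms
    by (intro conjI exI[of _ \<mu>] exI[of _ "null_measure circle_lborel"]) (auto simp: poisson_integral_def)
qed

lemma harmonic_on_cmult:
  assumes "harmonic_on h unit_disc"
  shows "harmonic_on (\<lambda>z. c * h z) unit_disc"
proof -
  obtain F where F: "F holomorphic_on unit_disc" "\<And>z. z \<in> unit_disc \<Longrightarrow> h z = Re (F z)"
    using harmonic_on_disc_imp_Re_holomorphic[OF assms] by blast
  show ?thesis
    by (rule harmonic_on_Re_holomorphic[of _ "\<lambda>z. of_real c * F z"]) (auto intro!: holomorphic_intros F)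
qed

theorem proposition1p6:
  fixes \<alpha> :: real
  shows "(\<forall>\<phi>. nonneg_borel \<phi> \<and> (\<exists>h. harmonic_majorant \<phi> h)
            \<longrightarrow> nt_max \<alpha> \<phi> \<in> weak_L1)
       \<and> (\<forall>\<phi>. nonneg_borel \<phi> \<and>
              (\<exists>h. harmonic_majorant \<phi> h \<and> quasi_bounded h \<and> (\<forall>z\<in>unit_disc. 0 \<le> h z))
            \<longrightarrow> nt_max \<alpha> \<phi> \<in> weak_L1_0)
       \<and> (1 \<le> \<alpha> \<longrightarrow>
            (\<exists>C>0. \<forall>\<phi>. nonneg_borel \<phi> \<and> nt_max \<alpha> \<phi> \<in> L1 \<longrightarrow>
               quasi_bounded (poisson_integral (density circle_lebesgue (nt_max \<alpha> \<phi>))) \<and>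
               harmonic_majorant \<phi>
                 (\<lambda>z. C * poisson_integral (density circle_lebesgue (nt_max \<alpha> \<phi>)) z)))"
proof (intro conjI allI impI)
  fix \<phi> assume "nonneg_borel \<phi> \<and> (\<exists>h. harmonic_majorant \<phi> h)"
  then show "nt_max \<alpha> \<phi> \<in> weak_L1" using nt_max_weak_L1 by blast
next
  fix \<phi> assume "nonneg_borel \<phi> \<and> (\<exists>h. harmonic_majorant \<phi> h \<and> quasi_bounded h \<and> (\<forall>z\<in>unit_disc. 0 \<le> h z))"
  then obtain h \<mu> \<nu> where \<phi>: "nonneg_borel \<phi>" and maj: "\<And>z. z \<in> unit_disc \<Longrightarrow> \<phi> z \<le> h z"
    and \<mu>: "ac_boundary_measure \<mu>"
    and h: "\<And>z. z \<in> unit_disc \<Longrightarrow> h z = poisson_integral \<mu> z - poisson_integral \<nu> z"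
    unfolding harmonic_majorant_def quasi_bounded_def by blast
  show "nt_max \<alpha> \<phi> \<in> weak_L1_0"
  proof (rule nt_max_weak_L1_0[OF \<phi> \<mu>])
    fix z assume z: "z \<in> unit_disc"
    \<comment> \<open>The subtracted Poisson integral is nonnegative, so that of
      \<open>\<mu>\<close> alone majorizes \<open>\<phi>\<close> and the criterion for one positive
      measure applies.\<close>
    have "0 \<le> poisson_integral \<nu> z"
      unfolding poisson_integral_def using z by (intro integral_nonneg_AE AE_I2 poisson_kernel_nonneg) auto
    then show "\<phi> z \<le> poisson_integral \<mu> z" using maj[OF z] h[OF z] by simp
  qed
next
  assume \<alpha>: "1 \<le> \<alpha>"
  show "\<exists>C>0. \<forall>\<phi>. nonneg_borel \<phi> \<and> nt_max \<alpha> \<phi> \<in> L1 \<longrightarrow>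
               quasi_bounded (poisson_integral (density circle_lebesgue (nt_max \<alpha> \<phi>))) \<and>
               harmonic_majorant \<phi>
                 (\<lambda>z. C * poisson_integral (density circle_lebesgue (nt_max \<alpha> \<phi>)) z)"
  proof (intro exI[of _ "4 * pi * \<alpha>\<^sup>2"] conjI allI impI)
    show "0 < 4 * pi * \<alpha>\<^sup>2" using \<alpha> by simp
    fix \<phi> assume "nonneg_borel \<phi> \<and> nt_max \<alpha> \<phi> \<in> L1"
    then have \<phi>: "nonneg_borel \<phi>" and L1: "(\<integral>\<^sup>+\<zeta>. nt_max \<alpha> \<phi> \<zeta> \<partial>circle_lborel) < \<infinity>"
      by (auto simp: L1_def circle_lebesgue_def nn_integral_completion)
    note f = nt_max_measurable[OF \<phi>, of \<alpha>]
    have "emeasure (density circle_lborel (nt_max \<alpha> \<phi>)) (space circle_lborel) = (\<integral>\<^sup>+\<zeta>. nt_max \<alpha> \<phi> \<zeta> \<partial>circle_lborel)"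
      using f by (subst emeasure_density) (auto intro!: nn_integral_cong)
    then have fin: "finite_measure (density circle_lborel (nt_max \<alpha> \<phi>))"
      using L1 by (intro finite_measureI) simp
    have ac: "ac_boundary_measure (density circle_lborel (nt_max \<alpha> \<phi>))"
      using fin absolutely_continuousI_density[OF f] by (simp add: ac_boundary_measure_def)
    show qb: "quasi_bounded (poisson_integral (density circle_lebesgue (nt_max \<alpha> \<phi>)))"
      unfolding poisson_integral_density_circle_lebesgue[OF f] by (rule quasi_bounded_poisson_integral[OF ac])
    show "harmonic_majorant \<phi> (\<lambda>z. 4 * pi * \<alpha>\<^sup>2 * poisson_integral (density circle_lebesgue (nt_max \<alpha> \<phi>)) z)"
      unfolding harmonic_majorant_def
    proof (intro conjI ballI harmonic_on_cmult)
      show "harmonic_on (poisson_integral (density circle_lebesgue (nt_max \<alpha> \<phi>))) unit_disc"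
        using qb by (simp add: quasi_bounded_def)
      show "\<phi> z \<le> 4 * pi * \<alpha>\<^sup>2 * poisson_integral (density circle_lebesgue (nt_max \<alpha> \<phi>)) z" if "z \<in> unit_disc" for z
        unfolding poisson_integral_density_circle_lebesgue[OF f]
        using le_poisson_integral_nt_max[OF \<alpha> \<phi> _ fin] that by simp
    qed
  qed
qed

end
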